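(* Let $1\le p<\infty$ and let $g$ be analytic in the unit disc $\mathbb{D}$. Then the following two conditions are equivalent: (1) The operator $\mathcal{H}_g$ is bounded from $H^\infty$ to $X_p$. (2) $g\in X_p$.
   Context: $\mathbb{D}$ is the open unit disc of $\mathbb{C}$ and $H(\mathbb{D})$ is the space of all analytic functions in $\mathbb{D}$. For $g\in H(\mathbb{D})$ the generalized Hilbert operator is $\mathcal{H}_g(f)(z)=\int_0^1 f(t)g'(tz)\,dt$, $z\in\mathbb{D}$. $H^\infty$ is the space of bounded analytic functions in $\mathbb{D}$ with the sup norm. For $0<p<\infty$, $0\le r<1$, $f\in H(\mathbb{D})$, $M_p(r,f)=\left(\frac1{2\pi}\int_0^{2\pi}|f(re^{i\theta})|^p\,d\theta\right)^{1/p}$. For $p>1$, $X_p=\Lambda^p_{1/p}$ is the mean Lipschitz space, i.e. the space of $f\in H(\mathbb{D})$ with $M_p(r,f')=O\left((1-r^2)^{-(1-1/p)}\right)$ as $r\to1$, normed by $|f(0)|+\sup_{0\le r<1}(1-r^2)^{1-1/p}M_p(r,f')$. For $p=1$, $X_1=H^{1,\infty,1}_2$ is the space of $f(z)=\sum_{n\ge0}a_nz^n\in H(\mathbb{D})$ with $\sup_{0\le r<1}(1-r)M_1(r,D^2f)<\infty$, normed by this supremum, where $D^2f(z)=\sum_{n=0}^\infty(n+1)^2a_nz^n$. *)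

theory Defs
  imports "HOL-Complex_Analysis.Complex_Analysis" "HOL-Library.Landau_Symbols"
begin

text \<open>
  An analytic function on the unit disc \<open>ball 0 1\<close> is represented by a total function
  of type \<^typ>\<open>complex \<Rightarrow> complex\<close> that is holomorphic on the disc; no definition below depends
  on its values outside the disc. (The operator \<open>gen_hilbert\<close> evaluates its argument at the
  single boundary point \<open>1\<close>, which does not affect the integral.)
\<close>

definition integral_mean :: "real \<Rightarrow> real \<Rightarrow> (complex \<Rightarrow> complex) \<Rightarrow> real" where
  "integral_mean p r f =
     (1 / (2 * pi) * integral {0..2 * pi} (\<lambda>\<theta>. norm (f (of_real r * cis \<theta>)) powr p)) powr (1 / p)"

definition gen_hilbert :: "(complex \<Rightarrow> complex) \<Rightarrow> (complex \<Rightarrow> complex) \<Rightarrow> complex \<Rightarrow> complex" where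
  "gen_hilbert g f z = integral {0..1::real} (\<lambda>t. f (of_real t) * deriv g (of_real t * z))"

definition H_infinity :: "(complex \<Rightarrow> complex) set" where
  "H_infinity = {f. f holomorphic_on ball 0 1 \<and> bounded (f ` ball 0 1)}"

definition H_infinity_norm :: "(complex \<Rightarrow> complex) \<Rightarrow> real" where
  "H_infinity_norm f = (SUP z\<in>ball 0 1. norm (f z))"

text \<open>
  The space \<open>\<Lambda>\<^sup>p\<close> of order \<open>1/p\<close>, for \<open>p > 1\<close>. On this space the supremum in the norm
  is finite: the growth condition controls the means for \<open>r\<close> near \<open>1\<close>, and \<open>f'\<close> is
  bounded on smaller closed discs.
\<close>

definition mean_Lipschitz :: "real \<Rightarrow> (complex \<Rightarrow> complex) set" where
  "mean_Lipschitz p = {f. f holomorphic_on ball 0 1 \<and>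
     (\<lambda>r. integral_mean p r (deriv f)) \<in> O[at_left 1](\<lambda>r. (1 - r\<^sup>2) powr (- (1 - 1 / p)))}"

definition mean_Lipschitz_norm :: "real \<Rightarrow> (complex \<Rightarrow> complex) \<Rightarrow> real" where
  "mean_Lipschitz_norm p f =
     norm (f 0) + (SUP r\<in>{0..<1}. (1 - r\<^sup>2) powr (1 - 1 / p) * integral_mean p r (deriv f))"

text \<open>\<open>(deriv ^^ n) f 0 / fact n\<close> is the Taylor coefficient \<open>a\<^sub>n\<close> of \<open>f\<close> at \<open>0\<close>.\<close>

definition D2 :: "(complex \<Rightarrow> complex) \<Rightarrow> complex \<Rightarrow> complex" where
  "D2 f z = (\<Sum>n. of_nat ((n + 1)\<^sup>2) * ((deriv ^^ n) f 0 / fact n) * z ^ n)"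

definition H_1_inf_1_2 :: "(complex \<Rightarrow> complex) set" where
  "H_1_inf_1_2 = {f. f holomorphic_on ball 0 1 \<and>
     bdd_above ((\<lambda>r. (1 - r) * integral_mean 1 r (D2 f)) ` {0..<1})}"

definition H_1_inf_1_2_norm :: "(complex \<Rightarrow> complex) \<Rightarrow> real" where
  "H_1_inf_1_2_norm f = (SUP r\<in>{0..<1}. (1 - r) * integral_mean 1 r (D2 f))"

definition X_space :: "real \<Rightarrow> (complex \<Rightarrow> complex) set" where
  "X_space p = (if p = 1 then H_1_inf_1_2 else mean_Lipschitz p)"

definition X_norm :: "real \<Rightarrow> (complex \<Rightarrow> complex) \<Rightarrow> real" where
  "X_norm p f = (if p = 1 then H_1_inf_1_2_norm f else mean_Lipschitz_norm p f)"

definition bounded_operator ::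
  "('a set \<Rightarrow> ('a \<Rightarrow> real) \<Rightarrow> 'b set \<Rightarrow> ('b \<Rightarrow> real) \<Rightarrow> ('a \<Rightarrow> 'b) \<Rightarrow> bool)" where
  "bounded_operator A normA B normB T \<longleftrightarrow>
     (\<forall>f\<in>A. T f \<in> B) \<and> (\<exists>C. \<forall>f\<in>A. normB (T f) \<le> C * normA f)"

end

theory Submission
  imports Defs
begin

text \<open>
  For every \<open>p \<ge> 1\<close>, including \<open>p = 1\<close>, membership of \<open>f\<close> in \<open>X\<^sub>p\<close> means
  \<open>M\<^sub>p(r, f'') = O((1 - r) powr -(2 - 1/p))\<close>: differentiation raises the order of growth by one (Cauchy's
  formula), integration keeps it and even lowers it by one when it exceeds \<open>1\<close>, and for \<open>p = 1\<close>
  one uses \<open>D\<^sup>2 f = f + 3 z f' + z\<^sup>2 f''\<close> and \<open>D\<^sup>2 f = E (E f)\<close> with \<open>E v = v + z v'\<close>, whose inverse is the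
  mean \<open>\<integral>\<^sub>0\<^sup>1 v(tz) dt\<close>.

  If \<open>g\<close> is in \<open>X\<^sub>p\<close>, then \<open>g'''\<close> has order \<open>3 - 1/p > 1\<close>, and Minkowski's inequality applied to
  \<open>(H\<^sub>g f)''(z) = \<integral>\<^sub>0\<^sup>1 t\<^sup>2 f(t) g'''(tz) dt\<close> gains one order, using only the boundedness of \<open>f\<close>.
  Conversely, \<open>h = H\<^sub>g 1\<close> satisfies \<open>g = g(0) + z h\<close>, so \<open>g'' = 2 h' + z h''\<close>.
\<close>

subsection \<open>Integral inequalities\<close>

text \<open>Convexity of \<open>x powr p\<close>. The endpoint \<open>x = 0\<close> is treated
  apart; there the claim reduces to \<open>(1 - p) * a powr p \<le> 0\<close>.\<close>

lemma powr_ge_tangent: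
  fixes x a p :: real
  assumes "1 \<le> p" "0 \<le> x" "0 < a"
  shows "a powr p + p * a powr (p - 1) * (x - a) \<le> x powr p"
proof (cases "x = 0")
  case True
  have "a powr p = a powr (p - 1) * a"
    using assms powr_add[of a "p - 1" 1] by simp
  then have "a powr p + p * a powr (p - 1) * (x - a) = (1 - p) * a powr p"
    using True by (simp add: algebra_simps)
  also have "\<dots> \<le> 0"
    using assms by (intro mult_nonpos_nonneg) auto
  finally show ?thesis using True by simp
next
  case False
  have "x powr p - a powr p \<ge> (p * a powr (p - 1)) * (x - a)"
    by (rule convex_on_imp_above_tangent[OF powr_convex])
       (use assms False in \<open>auto intro!: derivative_eq_intros simp: interior_open\<close>)
  then show ?thesis by simp
qed

text \<open>This is \<open>powr_ge_tangent\<close> for \<open>x = k / w\<close> at the point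
  \<open>m\<close>, multiplied by \<open>w\<close>. The lower bound is linear in
  \<open>(k, w)\<close>, so it can be integrated or summed; a suitable choice of \<open>m\<close>
  then yields inequalities of Hoelder type.\<close>

lemma perspective_powr_ge_tangent:
  fixes k w m p :: real
  assumes "1 \<le> p" "0 \<le> k" "0 < w" "0 < m"
  shows "w * m powr p + p * m powr (p - 1) * k - p * m powr p * w \<le> k powr p * w powr (1 - p)"
proof -
  have mp: "m powr p = m powr (p - 1) * m"
    using assms powr_add[of m "p - 1" 1] by simp
  have "w * (m powr p + p * m powr (p - 1) * (k / w - m)) \<le> w * (k / w) powr p"
    using assms by (intro mult_left_mono powr_ge_tangent) auto
  moreover have "w * (k / w) powr p = k powr p * w powr (1 - p)"
    using assms by (simp add: powr_divide powr_diff)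
  moreover have "w * (m powr p + p * m powr (p - 1) * (k / w - m))
      = w * m powr p + p * m powr (p - 1) * k - p * (m powr (p - 1) * m) * w"
    using assms by (simp add: field_simps)
  ultimately show ?thesis using mp by simp
qed

text \<open>Hoelder's inequality for \<open>k / w\<close> against the measure \<open>w dt\<close>,
  obtained by integrating the tangent inequality with one fixed \<open>m\<close>.\<close>

lemma integral_powr_le_weighted:
  fixes k w :: "real \<Rightarrow> real"
  assumes p: "1 \<le> p" and "a < b"
    and k: "continuous_on {a..b} k" "\<And>t. t \<in> {a..b} \<Longrightarrow> 0 \<le> k t"
    and w: "continuous_on {a..b} w" "\<And>t. t \<in> {a..b} \<Longrightarrow> 0 < w t"
  shows "(integral {a..b} k) powr p
      \<le> (integral {a..b} w) powr (p - 1) * integral {a..b} (\<lambda>t. k t powr p * w t powr (1 - p))"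
proof -
  define W where "W = integral {a..b} w"
  define A where "A = integral {a..b} k"
  have cont: "continuous_on {a..b} (\<lambda>t. k t powr p * w t powr (1 - p))"
    using p k w by (intro continuous_intros continuous_on_powr') (auto simp: less_le)
  have W: "0 < W"
    unfolding W_def
    using integral_less_real[where f = "\<lambda>_. 0" and g = w and a = a and b = b] \<open>a < b\<close> w
    by (auto simp: integrable_continuous_real)
  have A: "0 \<le> A"
    unfolding A_def using k by (intro integral_nonneg integrable_continuous_real) auto
  show ?thesis
  proof (cases "A = 0")
    case True
    have "0 \<le> integral {a..b} (\<lambda>t. k t powr p * w t powr (1 - p))"
      by (intro integral_nonneg integrable_continuous_real cont) auto
    then show ?thesis using True by (auto simp: A_def)
  next
    case False
    \<comment> \<open>The weighted mean of \<open>k / w\<close>. Since \<open>A = m * W\<close>, the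
      two terms carrying the factor \<open>p\<close> cancel after integration and
      \<open>W * m powr p\<close> remains.\<close>
    define m where "m = A / W"
    have m: "0 < m" using False A W by (simp add: m_def)
    have mp: "m powr p = m powr (p - 1) * m"
      using m powr_add[of m "p - 1" 1] by simp
    have "((\<lambda>t. w t * m powr p + p * m powr (p - 1) * k t - p * m powr p * w t) has_integral
        W * m powr p + p * m powr (p - 1) * A - p * m powr p * W) {a..b}"
      unfolding W_def A_def
      by (intro has_integral_diff has_integral_add has_integral_mult_left has_integral_mult_right
            integrable_integral integrable_continuous_real k w)
    then have "W * m powr p + p * m powr (p - 1) * A - p * m powr p * W
        = integral {a..b} (\<lambda>t. w t * m powr p + p * m powr (p - 1) * k t - p * m powr p * w t)"
      by (simp add: integral_unique)
    also have "\<dots> \<le> integral {a..b} (\<lambda>t. k t powr p * w t powr (1 - p))"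
      by (intro integral_le integrable_continuous_real cont continuous_intros k w
            perspective_powr_ge_tangent p m) auto
    finally have "W * m powr p \<le> integral {a..b} (\<lambda>t. k t powr p * w t powr (1 - p))"
      using W unfolding mp by (simp add: m_def algebra_simps)
    then have "W powr (p - 1) * (W * m powr p)
        \<le> W powr (p - 1) * integral {a..b} (\<lambda>t. k t powr p * w t powr (1 - p))"
      by (intro mult_left_mono) auto
    moreover have "W powr (p - 1) * (W * m powr p) = A powr p"
      using W A by (simp add: m_def powr_divide powr_diff)
    ultimately show ?thesis by (simp add: A_def W_def)
  qed
qed

text \<open>Writing \<open>w = s * cis \<alpha>\<close> turns the factor \<open>w\<close> into a
  shift of the angle, and the integral of a periodic function over a full period ignores shifts. The
  Cauchy estimate needs this for points of arbitrary argument.\<close>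

lemma integral_circle_rotate:
  fixes h :: "complex \<Rightarrow> 'a::banach"
  assumes h: "continuous_on (sphere 0 s) h" and w: "norm w = s"
  shows "integral {0..2 * pi} (\<lambda>\<theta>. h (cis \<theta> * w)) = integral {0..2 * pi} (\<lambda>\<theta>. h (of_real s * cis \<theta>))"
proof -
  have s: "0 \<le> s" using w norm_ge_zero by metis
  obtain \<alpha> where \<alpha>: "0 \<le> \<alpha>" "\<alpha> < 2 * pi" "w = of_real s * cis \<alpha>"
    using Arg2pi[of w] w that[of "Arg2pi w"] by (auto simp: cis_conv_exp is_Arg_def)
  define H where "H \<theta> = h (of_real s * cis \<theta>)" for \<theta> :: real
  have cont: "continuous_on S H" for S
    unfolding H_def using s
    by (intro continuous_on_compose2[OF h] continuous_intros) (auto simp: norm_mult)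
  have int: "H integrable_on {a..b}" for a b
    by (intro integrable_continuous_real cont)
  have per: "H \<circ> (+) (2 * pi) = H"
    by (auto simp: H_def fun_eq_iff simp flip: cis_mult)
  have "integral {0..2 * pi} (\<lambda>\<theta>. h (cis \<theta> * w)) = integral {0..2*pi} (H \<circ> (+) \<alpha>)"
    by (rule arg_cong2[where f=integral])
       (auto simp: H_def fun_eq_iff \<alpha>(3) cis_mult[symmetric] mult_ac)
  also have "\<dots> = integral {\<alpha>..2*pi + \<alpha>} H"
    by (subst integral_shift_Icc_real) simp
  also have "\<dots> = integral {\<alpha>..2*pi} H + integral {2*pi..2*pi+\<alpha>} H"
    using \<alpha> by (intro Henstock_Kurzweil_Integration.integral_combine[symmetric] int) auto
  also have "integral {2*pi..2*pi+\<alpha>} H = integral {0..\<alpha>} H"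
    using integral_shift_Icc_real[of 0 \<alpha> H "2 * pi"] unfolding per by (simp add: add.commute)
  also have "integral {\<alpha>..2*pi} H + integral {0..\<alpha>} H = integral {0..2*pi} H"
    using \<alpha> by (subst add.commute) (intro Henstock_Kurzweil_Integration.integral_combine int; auto)
  finally show ?thesis by (simp add: H_def[abs_def])
qed

subsection \<open>Integral means\<close>

lemma continuous_on_mean_integrand:
  assumes "continuous_on (sphere 0 r) f" "0 \<le> r" "0 < p"
  shows "continuous_on {0..2 * pi} (\<lambda>\<theta>. norm (f (of_real r * cis \<theta>)) powr p)"
  using assms
  by (intro continuous_on_powr' continuous_intros continuous_on_compose2[OF assms(1)])
     (auto simp: norm_mult)

lemma integral_mean_nonneg: "0 \<le> integral_mean p r f"
  by (simp add: integral_mean_def)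

text \<open>Raising to the power \<open>p\<close> removes the outer root, so that later estimates
  compare plain integrals.\<close>

lemma integral_mean_le_iff:
  assumes "0 < p" "0 \<le> A"
  shows "integral_mean p r f \<le> A \<longleftrightarrow>
    integral {0..2 * pi} (\<lambda>\<theta>. norm (f (of_real r * cis \<theta>)) powr p) \<le> 2 * pi * A powr p"
proof -
  define I where "I = 1 / (2 * pi) * integral {0..2 * pi} (\<lambda>\<theta>. norm (f (of_real r * cis \<theta>)) powr p)"
  \<comment> \<open>A non-integrable integrand has integral 0 by convention, so the sign is right
    for every \<open>f\<close>.\<close>
  have "0 \<le> integral {0..2 * pi} (\<lambda>\<theta>. norm (f (of_real r * cis \<theta>)) powr p)"
    by (cases "(\<lambda>\<theta>. norm (f (of_real r * cis \<theta>)) powr p) integrable_on {0..2 * pi}")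
       (auto intro!: integral_nonneg simp: not_integrable_integral)
  then have I: "0 \<le> I" by (simp add: I_def)
  have "I powr (1 / p) \<le> A \<longleftrightarrow> (I powr (1 / p)) powr p \<le> A powr p"
    using assms powr_mono2[of p "I powr (1 / p)" A] powr_less_mono2[of p A "I powr (1 / p)"]
    by (auto simp flip: not_less)
  also have "(I powr (1 / p)) powr p = I"
    using assms I by (simp add: powr_powr)
  finally show ?thesis
    unfolding integral_mean_def I_def[symmetric] by (simp add: I_def field_simps)
qed

text \<open>Minkowski's integral inequality, with the norms of the slices bounded by a continuous
  positive weight, so that no measurability of the exact slice norms enters.\<close>

lemma integral_mean_le_integral:
  fixes K :: "real \<Rightarrow> real \<Rightarrow> real" and w :: "real \<Rightarrow> real"
  assumes p: "1 \<le> p" and "a < b" and "0 \<le> A" and r: "0 \<le> r"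
    and F: "continuous_on (sphere 0 r) F"
    and K: "continuous_on ({a..b} \<times> {0..2 * pi}) (\<lambda>(t, \<theta>). K t \<theta>)"
    and K_nonneg: "\<And>t \<theta>. t \<in> {a..b} \<Longrightarrow> \<theta> \<in> {0..2 * pi} \<Longrightarrow> 0 \<le> K t \<theta>"
    and w: "continuous_on {a..b} w" "\<And>t. t \<in> {a..b} \<Longrightarrow> 0 < w t"
    and slice: "\<And>t. t \<in> {a..b} \<Longrightarrow>
      integral {0..2 * pi} (\<lambda>\<theta>. K t \<theta> powr p) \<le> 2 * pi * (A * w t) powr p"
    and F_le: "\<And>\<theta>. \<theta> \<in> {0..2 * pi} \<Longrightarrow>
      norm (F (of_real r * cis \<theta>)) \<le> integral {a..b} (\<lambda>t. K t \<theta>)"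
  shows "integral_mean p r F \<le> A * integral {a..b} w"
proof -
  define W where "W = integral {a..b} w"
  have W: "0 \<le> W"
    unfolding W_def using w by (intro integral_nonneg integrable_continuous_real) (auto simp: less_imp_le)
  have cK: "continuous_on {a..b} (\<lambda>t. K t \<theta>)" if "\<theta> \<in> {0..2 * pi}" for \<theta>
    by (rule continuous_on_compose2[OF K, where f = "\<lambda>t. (t, \<theta>)", simplified])
       (use that in \<open>auto intro!: continuous_intros\<close>)
  have cK2: "continuous_on {0..2 * pi} (\<lambda>\<theta>. K t \<theta>)" if "t \<in> {a..b}" for t
    by (rule continuous_on_compose2[OF K, where f = "\<lambda>\<theta>. (t, \<theta>)", simplified])
       (use that in \<open>auto intro!: continuous_intros\<close>)
  have cKw: "continuous_on ({a..b} \<times> {0..2 * pi}) (\<lambda>(t, \<theta>). K t \<theta> powr p * w t powr (1 - p))"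
    unfolding case_prod_unfold
    using p w K_nonneg K
    by (intro continuous_on_mult continuous_on_powr' continuous_on_const
          continuous_on_compose2[OF w(1)] continuous_on_fst continuous_on_id)
       (auto simp: case_prod_unfold less_le)
  have cKw': "continuous_on ({0..2 * pi} \<times> {a..b}) (\<lambda>(\<theta>, t). K t \<theta> powr p * w t powr (1 - p))"
    using continuous_on_swap_args[OF cKw] .
  have cont1: "continuous_on {0..2 * pi} (\<lambda>\<theta>. integral {a..b} (\<lambda>t. K t \<theta> powr p * w t powr (1 - p)))"
    using integral_continuous_on_param[of "{0..2 * pi}" a b "\<lambda>\<theta> t. K t \<theta> powr p * w t powr (1 - p)"] cKw'
    by simp
  have cont2: "continuous_on {a..b} (\<lambda>t. integral {0..2 * pi} (\<lambda>\<theta>. K t \<theta> powr p * w t powr (1 - p)))"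
    using integral_continuous_on_param[of "{a..b}" 0 "2 * pi" "\<lambda>t \<theta>. K t \<theta> powr p * w t powr (1 - p)"] cKw
    by simp
  \<comment> \<open>The weighted Hoelder inequality in \<open>t\<close> for each angle; then the
    order of integration is exchanged and the slice bounds enter.\<close>
  have "integral {0..2 * pi} (\<lambda>\<theta>. norm (F (of_real r * cis \<theta>)) powr p)
      \<le> integral {0..2 * pi} (\<lambda>\<theta>. W powr (p - 1) *
            integral {a..b} (\<lambda>t. K t \<theta> powr p * w t powr (1 - p)))"
  proof (intro integral_le integrable_continuous_real)
    show "continuous_on {0..2 * pi} (\<lambda>\<theta>. W powr (p - 1) *
            integral {a..b} (\<lambda>t. K t \<theta> powr p * w t powr (1 - p)))"
      by (intro continuous_on_mult continuous_on_const cont1)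
    show "continuous_on {0..2 * pi} (\<lambda>\<theta>. norm (F (of_real r * cis \<theta>)) powr p)"
      using F r p by (intro continuous_on_mean_integrand) auto
    fix \<theta> :: real assume \<theta>: "\<theta> \<in> {0..2 * pi}"
    have "norm (F (of_real r * cis \<theta>)) powr p \<le> (integral {a..b} (\<lambda>t. K t \<theta>)) powr p"
      using p F_le[OF \<theta>] by (intro powr_mono2) auto
    also have "\<dots> \<le> W powr (p - 1) * integral {a..b} (\<lambda>t. K t \<theta> powr p * w t powr (1 - p))"
      unfolding W_def using \<open>a < b\<close> p cK[OF \<theta>] K_nonneg \<theta> w
      by (intro integral_powr_le_weighted) auto
    finally show "norm (F (of_real r * cis \<theta>)) powr p
        \<le> W powr (p - 1) * integral {a..b} (\<lambda>t. K t \<theta> powr p * w t powr (1 - p))" .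
  qed
  also have "\<dots> = W powr (p - 1) *
      integral {a..b} (\<lambda>t. integral {0..2 * pi} (\<lambda>\<theta>. K t \<theta> powr p * w t powr (1 - p)))"
    using integral_swap_continuous[of a 0 b "2 * pi" "\<lambda>t \<theta>. K t \<theta> powr p * w t powr (1 - p)"] cKw
    by (simp add: cbox_Pair_eq)
  \<comment> \<open>The slice bound supplies \<open>w t powr p\<close>; together with
    \<open>w t powr (1 - p)\<close> a single factor \<open>w t\<close> is left, whose integral is
    \<open>W\<close>.\<close>
  also have "\<dots> \<le> W powr (p - 1) * integral {a..b} (\<lambda>t. 2 * pi * A powr p * w t)"
  proof (intro mult_left_mono integral_le integrable_continuous_real cont2 continuous_intros w)
    fix t assume t: "t \<in> {a..b}"
    have "integral {0..2 * pi} (\<lambda>\<theta>. K t \<theta> powr p * w t powr (1 - p))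
        = integral {0..2 * pi} (\<lambda>\<theta>. K t \<theta> powr p) * w t powr (1 - p)"
      by simp
    also have "\<dots> \<le> (2 * pi * (A * w t) powr p) * w t powr (1 - p)"
      by (intro mult_right_mono slice t) auto
    also have "\<dots> = 2 * pi * A powr p * w t"
      using w(2)[OF t] by (simp add: powr_mult powr_diff)
    finally show "integral {0..2 * pi} (\<lambda>\<theta>. K t \<theta> powr p * w t powr (1 - p)) \<le> 2 * pi * A powr p * w t" .
  qed auto
  also have "\<dots> = 2 * pi * A powr p * (W powr (p - 1) * W)"
    by (simp add: W_def)
  also have "W powr (p - 1) * W = W powr p"
    using W powr_add[of W "p - 1" 1] by simp
  also have "2 * pi * A powr p * W powr p = 2 * pi * (A * W) powr p"
    by (simp add: powr_mult)
  finally show ?thesis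
    using p W \<open>0 \<le> A\<close> by (subst integral_mean_le_iff) (auto simp: W_def)
qed

section \<open>Comparison, scaling and triangle inequality for integral means\<close>

lemma integral_mean_cong:
  assumes "0 \<le> r" and "\<And>z. norm z = r \<Longrightarrow> norm (f z) = norm (g z)"
  shows "integral_mean p r f = integral_mean p r g"
proof -
  have "norm (f (of_real r * cis \<theta>)) = norm (g (of_real r * cis \<theta>))" for \<theta>
    using assms by (simp add: norm_mult)
  then show ?thesis by (simp add: integral_mean_def)
qed

lemma integral_mean_mono:
  assumes "0 < p" "0 \<le> r" and f: "continuous_on (sphere 0 r) f" and g: "continuous_on (sphere 0 r) g"
    and le: "\<And>z. norm z = r \<Longrightarrow> norm (f z) \<le> norm (g z)"
  shows "integral_mean p r f \<le> integral_mean p r g"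
proof -
  let ?I = "integral {0..2 * pi} (\<lambda>\<theta>. norm (f (of_real r * cis \<theta>)) powr p)"
  have "?I \<le> integral {0..2 * pi} (\<lambda>\<theta>. norm (g (of_real r * cis \<theta>)) powr p)"
    using assms
    by (intro integral_le integrable_continuous_real continuous_on_mean_integrand f g powr_mono2)
       (auto simp: norm_mult)
  also have "\<dots> \<le> 2 * pi * integral_mean p r g powr p"
    using integral_mean_le_iff[of p "integral_mean p r g" r g] assms integral_mean_nonneg by simp
  finally show ?thesis
    using integral_mean_le_iff[of p "integral_mean p r g" r f] assms integral_mean_nonneg by simp
qed

lemma integral_mean_const [simp]: "0 < p \<Longrightarrow> integral_mean p r (\<lambda>_. c) = norm c"
  by (simp add: integral_mean_def powr_powr)

lemma integral_mean_le_bound: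
  assumes "0 < p" "0 \<le> r" "continuous_on (sphere 0 r) f" and le: "\<And>z. norm z = r \<Longrightarrow> norm (f z) \<le> B"
  shows "integral_mean p r f \<le> B"
proof -
  have "0 \<le> B"
    using order_trans[OF norm_ge_zero le[of "of_real r"]] \<open>0 \<le> r\<close> by simp
  then have "integral_mean p r f \<le> integral_mean p r (\<lambda>_. of_real B)"
    using assms by (intro integral_mean_mono) auto
  then show ?thesis using \<open>0 < p\<close> \<open>0 \<le> B\<close> by simp
qed

lemma integral_mean_scale:
  assumes "0 < p" "0 \<le> r" and "continuous_on (sphere 0 r) f"
  shows "integral_mean p r (\<lambda>z. c * f z) = norm c * integral_mean p r f"
  using assms
  by (simp add: integral_mean_def norm_mult powr_mult powr_powr powr_divide)

text \<open>The argument of \<open>integral_powr_le_weighted\<close> with the integral over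
  \<open>t\<close> replaced by a sum of two terms, whose weights are bounds of the two
  means.\<close>

lemma integral_mean_add:
  assumes p: "1 \<le> p" and r: "0 \<le> r" and f: "continuous_on (sphere 0 r) f" and g: "continuous_on (sphere 0 r) g"
  shows "integral_mean p r (\<lambda>z. f z + g z) \<le> integral_mean p r f + integral_mean p r g"
proof (rule field_le_epsilon)
  fix e :: real assume e: "0 < e"
  \<comment> \<open>The additional \<open>e / 2\<close> keeps the weights positive when a mean
    vanishes.\<close>
  define A where "A = integral_mean p r f + e / 2"
  define B where "B = integral_mean p r g + e / 2"
  have AB: "0 < A" "0 < B" "integral_mean p r f \<le> A" "integral_mean p r g \<le> B"
    using e integral_mean_nonneg[of p r] by (auto simp: A_def B_def add_nonneg_pos)
  let ?x = "\<lambda>\<theta>. norm (f (of_real r * cis \<theta>))" and ?y = "\<lambda>\<theta>. norm (g (of_real r * cis \<theta>))"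
  have cx: "continuous_on {0..2 * pi} (\<lambda>\<theta>. ?x \<theta> powr p)" and cy: "continuous_on {0..2 * pi} (\<lambda>\<theta>. ?y \<theta> powr p)"
    using assms by (auto intro!: continuous_on_mean_integrand)
  have pointwise: "(x + y) powr p \<le> (A + B) powr (p - 1) * (x powr p * A powr (1 - p) + y powr p * B powr (1 - p))"
    if "0 \<le> x" "0 \<le> y" for x y :: real
  proof (cases "x + y = 0")
    case False
    \<comment> \<open>With this \<open>m\<close> the terms carrying the factor \<open>p\<close>
      cancel in the sum of the two tangent inequalities.\<close>
    define m where "m = (x + y) / (A + B)"
    have m: "0 < m" using False AB that by (simp add: m_def)
    have xy: "x + y = m * (A + B)" using AB by (simp add: m_def)
    have mp: "m powr p = m powr (p - 1) * m"
      using m powr_add[of m "p - 1" 1] by simp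
    have "(A + B) * m powr p = (A + B) * m powr p + p * m powr (p - 1) * (x + y) - p * m powr p * (A + B)"
      unfolding xy mp by (simp add: algebra_simps)
    also have "\<dots> \<le> x powr p * A powr (1 - p) + y powr p * B powr (1 - p)"
      using perspective_powr_ge_tangent[OF p \<open>0 \<le> x\<close> \<open>0 < A\<close> m]
        perspective_powr_ge_tangent[OF p \<open>0 \<le> y\<close> \<open>0 < B\<close> m]
      by (simp add: algebra_simps)
    finally have "(A + B) powr (p - 1) * ((A + B) * m powr p)
        \<le> (A + B) powr (p - 1) * (x powr p * A powr (1 - p) + y powr p * B powr (1 - p))"
      by (intro mult_left_mono) auto
    moreover have "(A + B) powr (p - 1) * ((A + B) * m powr p) = (x + y) powr p"
      using AB m unfolding xy by (simp add: powr_mult powr_diff)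
    ultimately show ?thesis by simp
  qed auto
  have "integral {0..2 * pi} (\<lambda>\<theta>. norm (f (of_real r * cis \<theta>) + g (of_real r * cis \<theta>)) powr p)
      \<le> integral {0..2 * pi} (\<lambda>\<theta>. (A + B) powr (p - 1) *
          (?x \<theta> powr p * A powr (1 - p) + ?y \<theta> powr p * B powr (1 - p)))"
  proof (intro integral_le integrable_continuous_real)
    show "continuous_on {0..2 * pi} (\<lambda>\<theta>. norm (f (of_real r * cis \<theta>) + g (of_real r * cis \<theta>)) powr p)"
      using p r by (intro continuous_on_mean_integrand continuous_intros f g) auto
    show "continuous_on {0..2 * pi} (\<lambda>\<theta>. (A + B) powr (p - 1) *
          (?x \<theta> powr p * A powr (1 - p) + ?y \<theta> powr p * B powr (1 - p)))"
      by (intro continuous_on_mult continuous_on_add continuous_on_const cx cy)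
    fix \<theta> :: real
    have "norm (f (of_real r * cis \<theta>) + g (of_real r * cis \<theta>)) powr p \<le> (?x \<theta> + ?y \<theta>) powr p"
      using p by (intro powr_mono2 norm_triangle_ineq) auto
    also have "\<dots> \<le> (A + B) powr (p - 1) * (?x \<theta> powr p * A powr (1 - p) + ?y \<theta> powr p * B powr (1 - p))"
      by (rule pointwise) auto
    finally show "norm (f (of_real r * cis \<theta>) + g (of_real r * cis \<theta>)) powr p
        \<le> (A + B) powr (p - 1) * (?x \<theta> powr p * A powr (1 - p) + ?y \<theta> powr p * B powr (1 - p))" .
  qed
  also have "\<dots> = (A + B) powr (p - 1) * (integral {0..2 * pi} (\<lambda>\<theta>. ?x \<theta> powr p) * A powr (1 - p)
      + integral {0..2 * pi} (\<lambda>\<theta>. ?y \<theta> powr p) * B powr (1 - p))"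
    by (intro integral_unique has_integral_mult_right has_integral_add has_integral_mult_left
          integrable_integral integrable_continuous_real cx cy)
  also have "\<dots> \<le> (A + B) powr (p - 1) * (2 * pi * A powr p * A powr (1 - p) + 2 * pi * B powr p * B powr (1 - p))"
    using AB p by (intro mult_left_mono add_mono mult_right_mono) (auto simp: integral_mean_le_iff)
  also have "\<dots> = 2 * pi * (A + B) powr p"
    using AB by (simp add: powr_diff field_simps)
  finally have "integral_mean p r (\<lambda>z. f z + g z) \<le> A + B"
    using AB p by (subst integral_mean_le_iff) auto
  then show "integral_mean p r (\<lambda>z. f z + g z) \<le> integral_mean p r f + integral_mean p r g + e"
    by (simp add: A_def B_def)
qed

subsection \<open>Growth classes\<close>

lemma holomorphic_continuous_on_sphere:
  assumes "f holomorphic_on ball 0 1" "r < 1"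
  shows "continuous_on (sphere 0 r) f"
  using assms by (auto intro!: holomorphic_on_imp_continuous_on intro: holomorphic_on_subset)

lemma deriv_holomorphic_on_ball:
  "f holomorphic_on ball 0 1 \<Longrightarrow> deriv f holomorphic_on ball (0::complex) 1"
  by (rule holomorphic_deriv) auto

text \<open>The constant \<open>C\<close> is kept explicit because the operator bound needs
  constants proportional to the sup norm of the argument. The bound ranges over all radii, so that
  it controls suprema directly.\<close>

definition mean_growth :: "real \<Rightarrow> real \<Rightarrow> real \<Rightarrow> (complex \<Rightarrow> complex) \<Rightarrow> bool" where
  "mean_growth p \<beta> C f \<longleftrightarrow> f holomorphic_on ball 0 1 \<and>
     (\<forall>r\<in>{0..<1}. integral_mean p r f \<le> C * (1 - r) powr - \<beta>)"

lemma mean_growthD: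
  assumes "mean_growth p \<beta> C f"
  shows "f holomorphic_on ball 0 1"
    and "0 \<le> r \<Longrightarrow> r < 1 \<Longrightarrow> integral_mean p r f \<le> C * (1 - r) powr - \<beta>"
    and "0 \<le> C"
proof -
  have "integral_mean p r f \<le> C * (1 - r) powr - \<beta>" if "0 \<le> r" "r < 1" for r
    using assms that by (auto simp: mean_growth_def)
  \<comment> \<open>The factor \<open>(1 - r) powr - \<beta>\<close> is 1 at \<open>r = 0\<close>,
    so \<open>C\<close> dominates a nonnegative mean.\<close>
  from this[of 0] show "0 \<le> C" using integral_mean_nonneg[of p 0 f] by simp
qed (use assms in \<open>auto simp: mean_growth_def\<close>)

lemma mean_growth_mono:
  assumes "mean_growth p \<beta> C f" "C \<le> D"
  shows "mean_growth p \<beta> D f"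
  using assms unfolding mean_growth_def by (meson mult_right_mono order_trans powr_ge_zero)

lemma mean_growth_cong:
  assumes "mean_growth p \<beta> C f" and eq: "\<And>z. norm z < 1 \<Longrightarrow> f z = g z"
  shows "mean_growth p \<beta> C g"
proof -
  have "g holomorphic_on ball 0 1"
    using mean_growthD(1)[OF assms(1)] by (rule holomorphic_transform) (auto simp: eq)
  moreover have "integral_mean p r g = integral_mean p r f" if "0 \<le> r" "r < 1" for r
    using that by (intro integral_mean_cong) (auto simp: eq)
  ultimately show ?thesis using assms(1) by (auto simp: mean_growth_def)
qed

lemma mean_growth_add:
  assumes "1 \<le> p" "mean_growth p \<beta> C f" "mean_growth p \<beta> D g"
  shows "mean_growth p \<beta> (C + D) (\<lambda>z. f z + g z)"
proof -
  note f = mean_growthD[OF assms(2)] and g = mean_growthD[OF assms(3)]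
  have "integral_mean p r (\<lambda>z. f z + g z) \<le> (C + D) * (1 - r) powr - \<beta>" if "0 \<le> r" "r < 1" for r
  proof -
    have "integral_mean p r (\<lambda>z. f z + g z) \<le> integral_mean p r f + integral_mean p r g"
      using that f(1) g(1) assms(1) by (intro integral_mean_add holomorphic_continuous_on_sphere) auto
    also have "\<dots> \<le> (C + D) * (1 - r) powr - \<beta>"
      using f(2) g(2) that by (simp add: distrib_right add_mono)
    finally show ?thesis .
  qed
  then show ?thesis using f g by (auto simp: mean_growth_def intro!: holomorphic_intros)
qed

lemma mean_growth_mult:
  assumes "1 \<le> p" and f: "mean_growth p \<beta> C f" and h: "h holomorphic_on ball 0 1"
    and B: "\<And>z. norm z < 1 \<Longrightarrow> norm (h z) \<le> B"
  shows "mean_growth p \<beta> (B * C) (\<lambda>z. h z * f z)"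
proof -
  have "0 \<le> B" using order_trans[OF norm_ge_zero B[of 0]] by simp
  have "integral_mean p r (\<lambda>z. h z * f z) \<le> B * C * (1 - r) powr - \<beta>" if r: "0 \<le> r" "r < 1" for r
  proof -
    have "integral_mean p r (\<lambda>z. h z * f z) \<le> integral_mean p r (\<lambda>z. of_real B * f z)"
      using r mean_growthD(1)[OF f] h assms(1) B \<open>0 \<le> B\<close>
      by (intro integral_mean_mono holomorphic_continuous_on_sphere holomorphic_intros)
         (auto simp: norm_mult intro!: mult_right_mono)
    also have "\<dots> = B * integral_mean p r f"
      using r mean_growthD(1)[OF f] assms(1) \<open>0 \<le> B\<close>
      by (subst integral_mean_scale) (auto intro: holomorphic_continuous_on_sphere)
    also have "\<dots> \<le> B * (C * (1 - r) powr - \<beta>)"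
      using mean_growthD(2)[OF f] r \<open>0 \<le> B\<close> by (intro mult_left_mono) auto
    finally show ?thesis by simp
  qed
  then show ?thesis using mean_growthD(1)[OF f] h by (auto simp: mean_growth_def intro!: holomorphic_intros)
qed

lemma mean_growth_const:
  assumes "1 \<le> p" "0 \<le> \<beta>"
  shows "mean_growth p \<beta> (norm c) (\<lambda>_. c)"
  using assms by (auto simp: mean_growth_def intro!: mult_left_le ge_one_powr_ge_zero
      simp: powr_minus one_le_inverse_iff powr_le1 mult_le_cancel_left1)

text \<open>On the compact disc of radius \<open>s\<close> the function is bounded, and for
  \<open>\<beta> \<ge> 0\<close> the factor \<open>(1 - r) powr - \<beta>\<close> is at least 1, so
  a larger constant covers the small radii.\<close>

lemma mean_growth_of_mean_growth_near_1:
  assumes "1 \<le> p" "0 \<le> \<beta>" and f: "f holomorphic_on ball 0 1" and "s < 1"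
    and near: "\<And>r. s < r \<Longrightarrow> r < 1 \<Longrightarrow> 0 \<le> r \<Longrightarrow> integral_mean p r f \<le> C * (1 - r) powr - \<beta>"
  shows "\<exists>C'. mean_growth p \<beta> C' f"
proof -
  have "compact (f ` cball 0 s)"
    using f \<open>s < 1\<close>
    by (intro compact_continuous_image holomorphic_on_imp_continuous_on)
       (auto intro: holomorphic_on_subset)
  then obtain D where "\<forall>w\<in>f ` cball 0 s. norm w \<le> D" "0 < D"
    using bounded_pos compact_imp_bounded by blast
  then have D: "\<And>z. norm z \<le> s \<Longrightarrow> norm (f z) \<le> D" "0 < D"
    by auto
  have "integral_mean p r f \<le> max C D * (1 - r) powr - \<beta>" if r: "0 \<le> r" "r < 1" for r
  proof (cases "r \<le> s")
    case True
    have "integral_mean p r f \<le> D"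
      using D r True assms(1) f by (intro integral_mean_le_bound holomorphic_continuous_on_sphere) auto
    also have "\<dots> \<le> max C D * 1" by simp
    also have "\<dots> \<le> max C D * (1 - r) powr - \<beta>"
      using D(2) r \<open>0 \<le> \<beta>\<close>
      by (intro mult_left_mono) (auto simp: powr_minus one_le_inverse_iff powr_le1)
    finally show ?thesis .
  next
    case False
    then show ?thesis
      using near[of r] r by (auto intro: order_trans mult_right_mono)
  qed
  then have "mean_growth p \<beta> (max C D) f" using f by (auto simp: mean_growth_def)
  then show ?thesis by blast
qed

section \<open>Cauchy's formula and the growth of the derivative\<close>

text \<open>Cauchy's formula for \<open>f'\<close> on the circle of radius \<open>\<rho>\<close>
  about the point. The disc is first rotated so that the centre becomes \<open>r\<close>; then
  \<open>\<theta>\<close> enters only through the factor \<open>cis \<theta>\<close>, and for fixed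
  \<open>\<phi>\<close> the argument of \<open>f\<close> runs over a circle about 0.\<close>

lemma norm_deriv_le_circle_integral:
  assumes f: "f holomorphic_on ball 0 1" and r: "0 \<le> r" and \<rho>: "0 < \<rho>" "r + \<rho> < 1"
  shows "norm (deriv f (of_real r * cis \<theta>))
    \<le> integral {0..2 * pi} (\<lambda>\<phi>. norm (f (cis \<theta> * (of_real r + of_real \<rho> * cis \<phi>))) / (2 * pi * \<rho>))"
proof -
  define G where "G u = f (cis \<theta> * u)" for u
  define I where "I = integral {0..2 * pi}
      (\<lambda>t. G (of_real r + of_real \<rho> * cis t) / (of_real r + of_real \<rho> * cis t - of_real r)\<^sup>2 * of_real \<rho> * \<i> * cis t)"
  have G: "G holomorphic_on ball 0 1"
    unfolding G_def
    by (rule holomorphic_on_compose_gen[OF _ f, unfolded o_def])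
       (auto intro!: holomorphic_intros simp: norm_mult)
  have sub: "cball (of_real r) \<rho> \<subseteq> ball (0::complex) 1"
  proof
    fix u :: complex assume "u \<in> cball (of_real r) \<rho>"
    then have "norm u \<le> r + \<rho>"
      using norm_triangle_ineq2[of u "of_real r"] r by (auto simp: dist_norm norm_minus_commute)
    then show "u \<in> ball 0 1" using \<rho> by simp
  qed
  have mem: "of_real r + of_real \<rho> * cis t \<in> ball (0::complex) 1" for t
  proof -
    have "dist (of_real r + of_real \<rho> * cis t) (of_real r) = \<rho>"
      using \<rho> by (simp add: dist_norm norm_mult)
    then show ?thesis using sub by (auto simp: subset_eq dist_commute)
  qed
  have contG: "continuous_on {0..2 * pi} (\<lambda>t. G (of_real r + of_real \<rho> * cis t))"
    using mem by (intro continuous_on_compose2[OF holomorphic_on_imp_continuous_on[OF G]] continuous_intros) auto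
  have "(G has_field_derivative 1 / (2 * of_real pi * \<i>) *
      contour_integral (circlepath (of_real r) \<rho>) (\<lambda>u. G u / (u - of_real r)\<^sup>2)) (at (of_real r))"
    using \<rho> holomorphic_on_subset[OF G sub] ball_subset_cball
    by (intro Cauchy_derivative_integral_circlepath)
       (auto intro: holomorphic_on_imp_continuous_on holomorphic_on_subset)
  moreover have "contour_integral (circlepath (of_real r) \<rho>) (\<lambda>u. G u / (u - of_real r)\<^sup>2) = I"
    unfolding circlepath_def I_def by (subst contour_integral_part_circlepath_eq) auto
  ultimately have "(G has_field_derivative 1 / (2 * of_real pi * \<i>) * I) (at (of_real r))"
    by simp
  moreover have "(G has_field_derivative deriv f (cis \<theta> * of_real r) * cis \<theta>) (at (of_real r))"
    unfolding G_def
    using f r \<rho> by (intro DERIV_chain2[where f = f] holomorphic_derivI[of f "ball 0 1"])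
      (auto intro!: derivative_eq_intros simp: norm_mult)
  ultimately have "deriv f (cis \<theta> * of_real r) * cis \<theta> = 1 / (2 * of_real pi * \<i>) * I"
    by (rule DERIV_unique[rotated])
  then have "norm (deriv f (cis \<theta> * of_real r)) = norm I / (2 * pi)"
    by (metis (no_types, lifting) mult.right_neutral norm_cis norm_divide norm_ii norm_mult norm_numeral
        norm_of_real norm_one abs_of_pos pi_gt_zero times_divide_eq_left mult_1)
  also have "norm I \<le> integral {0..2 * pi} (\<lambda>\<phi>. norm (G (of_real r + of_real \<rho> * cis \<phi>)) / \<rho>)"
    unfolding I_def
    using \<rho> by (intro integral_norm_bound_integral integrable_continuous_real continuous_intros contG)
      (auto simp: norm_mult norm_divide norm_power power2_eq_square)
  also have "integral {0..2 * pi} (\<lambda>\<phi>. norm (G (of_real r + of_real \<rho> * cis \<phi>)) / \<rho>) / (2 * pi) =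
      integral {0..2 * pi} (\<lambda>\<phi>. norm (G (of_real r + of_real \<rho> * cis \<phi>)) / (2 * pi * \<rho>))"
    by simp
  finally show ?thesis by (simp add: G_def mult.commute divide_right_mono)
qed

text \<open>Minkowski's inequality in \<open>\<phi>\<close> applied to the preceding estimate: each
  slice is a mean of \<open>f\<close> over a circle of radius at most \<open>r + \<rho>\<close>, and
  the kernel costs a factor \<open>1 / \<rho>\<close>.\<close>

lemma mean_growth_deriv:
  assumes p: "1 \<le> p" and \<beta>: "0 \<le> \<beta>" and f: "mean_growth p \<beta> C f"
  shows "mean_growth p (\<beta> + 1) (2 powr (\<beta> + 1) * C) (deriv f)"
  unfolding mean_growth_def
proof (intro conjI ballI)
  note holf = mean_growthD(1)[OF f]
  show hold: "deriv f holomorphic_on ball 0 1"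
    using holf by (rule deriv_holomorphic_on_ball)
  fix r :: real assume "r \<in> {0..<1}"
  then have r: "0 \<le> r" "r < 1" by auto
  \<comment> \<open>Half the distance to the boundary: since
    \<open>1 - (r + \<rho>) = \<rho>\<close>, the bound on \<open>f\<close> and the kernel are both
    powers of \<open>\<rho>\<close>. The halving produces
    \<open>2 powr (\<beta> + 1)\<close>.\<close>
  define \<rho> where "\<rho> = (1 - r) / 2"
  have \<rho>: "0 < \<rho>" "r + \<rho> < 1" using r by (auto simp: \<rho>_def field_simps)
  define A where "A = C * \<rho> powr - \<beta>"
  have A: "0 \<le> A" using mean_growthD(3)[OF f] by (simp add: A_def)
  let ?u = "\<lambda>\<phi>. of_real r + of_real \<rho> * cis \<phi> :: complex"
  have u: "norm (?u \<phi>) \<le> r + \<rho>" for \<phi>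
    using norm_triangle_ineq[of "of_real r" "of_real \<rho> * cis \<phi>"] r \<rho> by (simp add: norm_mult)
  have u1: "norm (?u \<phi>) < 1" for \<phi>
    using u[of \<phi>] \<rho> by linarith
  let ?K = "\<lambda>\<phi> \<theta>. norm (f (cis \<theta> * ?u \<phi>)) / (2 * pi * \<rho>)"
  have "integral_mean p r (deriv f) \<le> A * integral {0..2 * pi} (\<lambda>_::real. 1 / (2 * pi * \<rho>))"
  proof (rule integral_mean_le_integral[where K = ?K])
    show "continuous_on (sphere 0 r) (deriv f)"
      using hold r by (intro holomorphic_continuous_on_sphere)
    show "continuous_on ({0..2 * pi} \<times> {0..2 * pi}) (\<lambda>(t, \<theta>). ?K t \<theta>)"
      unfolding case_prod_unfold
      using \<rho> u1 by (intro continuous_intros continuous_on_compose2[OF holomorphic_on_imp_continuous_on[OF holf]])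
        (auto simp: norm_mult)
    show "norm (deriv f (of_real r * cis \<theta>)) \<le> integral {0..2 * pi} (\<lambda>t. ?K t \<theta>)" for \<theta>
      by (rule norm_deriv_le_circle_integral) (use holf r \<rho> in auto)
    fix \<phi> :: real
    define s where "s = norm (?u \<phi>)"
    have s: "0 \<le> s" "s \<le> r + \<rho>" "s < 1" using u[of \<phi>] \<rho> by (auto simp: s_def)
    have "integral_mean p s f \<le> C * (1 - s) powr - \<beta>"
      using mean_growthD(2)[OF f] s by simp
    also have "C * (1 - s) powr - \<beta> \<le> A"
    proof -
      have "\<rho> \<le> 1 - s"
        using s(2) unfolding \<rho>_def by argo
      then show ?thesis
        unfolding A_def using \<rho> \<beta> mean_growthD(3)[OF f]
        by (intro mult_left_mono powr_mono2') auto
    qed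
    finally have le: "integral_mean p s f \<le> A" .
    have "continuous_on (sphere 0 s) (\<lambda>z. norm (f z) powr p)"
      using holomorphic_continuous_on_sphere[OF holf s(3)] p
      by (intro continuous_on_powr' continuous_intros) auto
    \<comment> \<open>Rotation invariance discards the argument of \<open>?u \<phi>\<close> and
      leaves a mean over the circle of radius \<open>s\<close>.\<close>
    then have "integral {0..2 * pi} (\<lambda>\<theta>. norm (f (cis \<theta> * ?u \<phi>)) powr p)
        = integral {0..2 * pi} (\<lambda>\<theta>. norm (f (of_real s * cis \<theta>)) powr p)"
      by (rule integral_circle_rotate) (simp add: s_def)
    also have "\<dots> \<le> 2 * pi * A powr p"
      using le A p by (subst (asm) integral_mean_le_iff) auto
    finally have "integral {0..2 * pi} (\<lambda>\<theta>. norm (f (cis \<theta> * ?u \<phi>)) powr p) / (2 * pi * \<rho>) powr p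
        \<le> 2 * pi * A powr p / (2 * pi * \<rho>) powr p"
      by (rule divide_right_mono) auto
    then show "integral {0..2 * pi} (\<lambda>\<theta>. ?K \<phi> \<theta> powr p) \<le> 2 * pi * (A * (1 / (2 * pi * \<rho>))) powr p"
      using \<rho> A by (simp add: powr_divide)
  qed (use p r \<rho> A in auto)
  also have "\<dots> = 2 powr (\<beta> + 1) * C * (1 - r) powr - (\<beta> + 1)"
  proof -
    have "\<rho> powr - \<beta> / \<rho> = \<rho> powr - (\<beta> + 1)"
      using \<rho> powr_diff[of \<rho> "- \<beta>" 1] by simp
    also have "\<dots> = (1 - r) powr - (\<beta> + 1) * 2 powr (\<beta> + 1)"
    proof -
      have "2 powr - (\<beta> + 1) * 2 powr (\<beta> + 1) = (1::real)"
        by (simp flip: powr_add)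
      moreover have "(1 - r) powr - (\<beta> + 1) = 2 powr - (\<beta> + 1) * \<rho> powr - (\<beta> + 1)"
        unfolding powr_mult[symmetric] \<rho>_def by (rule arg_cong2[where f = "(powr)"]) auto
      ultimately show ?thesis by (simp add: mult_ac)
    qed
    finally show ?thesis using \<rho> by (simp add: A_def field_simps)
  qed
  finally show "integral_mean p r (deriv f) \<le> 2 powr (\<beta> + 1) * C * (1 - r) powr - (\<beta> + 1)" .
qed

subsection \<open>Weighted integrals along radii\<close>

text \<open>The operator \<open>gen_hilbert g f\<close> with \<open>h\<close> for
  \<open>deriv g\<close> and an arbitrary weight for \<open>f\<close>. The form is stable under
  differentiation, which adds a factor \<open>t\<close> to the weight and replaces \<open>h\<close>
  by \<open>h'\<close>; the weight 1 gives averages over radii.\<close>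

definition segment_transform :: "(real \<Rightarrow> complex) \<Rightarrow> (complex \<Rightarrow> complex) \<Rightarrow> complex \<Rightarrow> complex" where
  "segment_transform \<phi> h z = integral {0..1} (\<lambda>t. \<phi> t * h (of_real t * z))"

text \<open>Measurability instead of continuity, because a function in \<open>H_infinity\<close> may
  fail to have a limit at 1 along the segment.\<close>

definition bounded_weight :: "real \<Rightarrow> (real \<Rightarrow> complex) \<Rightarrow> bool" where
  "bounded_weight B \<phi> \<longleftrightarrow>
     \<phi> \<in> borel_measurable (lebesgue_on {0..1}) \<and> (\<forall>t\<in>{0..1}. norm (\<phi> t) \<le> B)"

lemma bounded_weight_bound: "bounded_weight B \<phi> \<Longrightarrow> 0 \<le> t \<Longrightarrow> t \<le> 1 \<Longrightarrow> norm (\<phi> t) \<le> B"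
  by (simp add: bounded_weight_def)

lemma bounded_weight_nonneg: "bounded_weight B \<phi> \<Longrightarrow> 0 \<le> B"
  using bounded_weight_bound[of B \<phi> 0] order_trans[OF norm_ge_zero] by auto

lemma bounded_weight_mult_id:
  assumes "bounded_weight B \<phi>"
  shows "bounded_weight B (\<lambda>t. of_real t * \<phi> t)"
proof -
  have "(\<lambda>t. of_real t :: complex) \<in> borel_measurable (lebesgue_on {0..1})"
    by (intro continuous_imp_measurable_on_sets_lebesgue continuous_intros) auto
  moreover have "norm (of_real t * \<phi> t) \<le> 1 * B" if "t \<in> {0..1}" for t :: real
    using that assms unfolding norm_mult by (intro mult_mono) (auto simp: bounded_weight_def)
  ultimately show ?thesis
    using assms by (auto simp: bounded_weight_def intro: borel_measurable_times)
qed

lemma bounded_weight_integrable: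
  assumes "bounded_weight B \<phi>" and \<psi>: "continuous_on {0..1} \<psi>"
  shows "(\<lambda>t. \<phi> t * \<psi> t) integrable_on {0..1}"
proof (rule measurable_bounded_by_integrable_imp_integrable[where g = "\<lambda>t. B * norm (\<psi> t)"])
  have "\<psi> \<in> borel_measurable (lebesgue_on {0..1})"
    using \<psi> by (intro continuous_imp_measurable_on_sets_lebesgue) auto
  then show "(\<lambda>t. \<phi> t * \<psi> t) \<in> borel_measurable (lebesgue_on {0..1})"
    using assms by (auto simp: bounded_weight_def intro: borel_measurable_times)
  show "(\<lambda>t. B * norm (\<psi> t)) integrable_on {0..1}"
    by (intro integrable_continuous_real continuous_intros \<psi>)
  show "norm (\<phi> t * \<psi> t) \<le> B * norm (\<psi> t)" if "t \<in> {0..1}" for t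
    using assms that unfolding norm_mult by (intro mult_right_mono) (auto simp: bounded_weight_def)
qed auto

lemma continuous_on_segment:
  assumes "h holomorphic_on ball 0 1" "norm z < 1"
  shows "continuous_on {0..1} (\<lambda>t. h (of_real t * z))"
proof (rule continuous_on_compose2[OF holomorphic_on_imp_continuous_on[OF assms(1)]])
  show "(\<lambda>t. of_real t * z) ` {0..1} \<subseteq> ball 0 1"
  proof clarsimp
    fix t :: real assume "0 \<le> t" "t \<le> 1"
    then have "t * norm z \<le> norm z" by (simp add: mult_left_le_one_le)
    then show "norm (of_real t * z) < 1" using assms(2) \<open>0 \<le> t\<close> by (simp add: norm_mult)
  qed
qed (intro continuous_intros)

section \<open>Power series, holomorphy and derivative of the transform\<close>

text \<open>Termwise integration of the Taylor series of \<open>h\<close>, justified by dominated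
  convergence; each coefficient is multiplied by a moment of \<open>\<phi>\<close>.\<close>

lemma segment_transform_sums:
  assumes \<phi>: "bounded_weight B \<phi>" and h: "h holomorphic_on ball 0 1" and z: "norm z < 1"
  shows "(\<lambda>n. (deriv ^^ n) h 0 / fact n * integral {0..1} (\<lambda>t. \<phi> t * of_real t ^ n) * z ^ n)
    sums segment_transform \<phi> h z"
proof -
  define c where "c n = (deriv ^^ n) h 0 / fact n" for n
  have c_sums: "(\<lambda>n. c n * w ^ n) sums h w" if "norm w < 1" for w
    using holomorphic_power_series[OF h, of w] that by (simp add: c_def)
  \<comment> \<open>The series converges at \<open>x\<close>, hence absolutely at the point
    \<open>z\<close> of smaller modulus.\<close>
  obtain x where x: "norm z < x" "x < 1" using dense z by blast
  have "summable (\<lambda>n. norm (c n * z ^ n))"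
    using x c_sums[of "of_real x"] order_le_less_trans[OF norm_ge_zero x(1)]
    by (intro powser_insidea[where x = "of_real x"]) (auto simp: sums_iff)
  then have sm: "summable (\<lambda>n. norm (c n * z ^ n))" .
  define f where "f k t = (\<Sum>n<k. \<phi> t * (c n * (of_real t * z) ^ n))" for k and t :: real
  have term_int: "((\<lambda>t. \<phi> t * (c n * (of_real t * z) ^ n)) has_integral
      c n * integral {0..1} (\<lambda>t. \<phi> t * of_real t ^ n) * z ^ n) {0..1}" for n
  proof -
    have "((\<lambda>t. \<phi> t * of_real t ^ n) has_integral integral {0..1} (\<lambda>t. \<phi> t * of_real t ^ n)) {0..1}"
      using \<phi> by (intro integrable_integral bounded_weight_integrable continuous_intros)
    then have "((\<lambda>t. c n * (\<phi> t * of_real t ^ n) * z ^ n) has_integral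
        c n * integral {0..1} (\<lambda>t. \<phi> t * of_real t ^ n) * z ^ n) {0..1}"
      by (intro has_integral_mult_left has_integral_mult_right)
    then show ?thesis by (simp add: power_mult_distrib mult_ac)
  qed
  have f_int: "(f k has_integral (\<Sum>n<k. c n * integral {0..1} (\<lambda>t. \<phi> t * of_real t ^ n) * z ^ n)) {0..1}" for k
    unfolding f_def by (intro has_integral_sum term_int) auto
  \<comment> \<open>Since \<open>0 \<le> t \<le> 1\<close>, all partial sums are dominated by the
    constant \<open>B * (\<Sum>n. norm (c n * z ^ n))\<close>.\<close>
  have "(\<lambda>k. integral {0..1} (f k)) \<longlonglongrightarrow> integral {0..1} (\<lambda>t. \<phi> t * h (of_real t * z))"
  proof (rule dominated_convergence(2)[where h = "\<lambda>_. B * (\<Sum>n. norm (c n * z ^ n))"])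
    show "f k integrable_on {0..1}" for k using f_int by blast
    fix t :: real assume t: "t \<in> {0..1}"
    have tz: "norm (of_real t * z) < 1"
    proof -
      have "t * norm z \<le> norm z" using t by (simp add: mult_left_le_one_le)
      then show ?thesis using z t by (simp add: norm_mult)
    qed
    show "norm (f k t) \<le> B * (\<Sum>n. norm (c n * z ^ n))" for k
    proof -
      have "norm (f k t) \<le> (\<Sum>n<k. norm (\<phi> t * (c n * (of_real t * z) ^ n)))"
        unfolding f_def by (rule norm_sum)
      also have "\<dots> \<le> (\<Sum>n<k. B * norm (c n * z ^ n))"
      proof (rule sum_mono)
        fix n
        have "\<bar>t\<bar> ^ n * norm (z ^ n) \<le> norm (z ^ n)"
          using t by (intro mult_left_le_one_le power_le_one) auto
        then have "norm (c n * (of_real t * z) ^ n) \<le> norm (c n * z ^ n)"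
          by (simp add: norm_mult norm_power power_mult_distrib mult_left_mono)
        then show "norm (\<phi> t * (c n * (of_real t * z) ^ n)) \<le> B * norm (c n * z ^ n)"
          unfolding norm_mult[of "\<phi> t"] using \<phi> t bounded_weight_nonneg[OF \<phi>]
          by (intro mult_mono) (auto simp: bounded_weight_def)
      qed
      also have "\<dots> = B * (\<Sum>n<k. norm (c n * z ^ n))" by (simp add: sum_distrib_left)
      also have "\<dots> \<le> B * (\<Sum>n. norm (c n * z ^ n))"
        using bounded_weight_nonneg[OF \<phi>] sm by (intro mult_left_mono sum_le_suminf) auto
      finally show ?thesis .
    qed
    show "(\<lambda>k. f k t) \<longlonglongrightarrow> \<phi> t * h (of_real t * z)"
      using sums_mult[OF c_sums[OF tz], of "\<phi> t"] by (simp add: sums_def f_def)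
  qed auto
  moreover have "integral {0..1} (f k) =
      (\<Sum>n<k. c n * integral {0..1} (\<lambda>t. \<phi> t * of_real t ^ n) * z ^ n)" for k
    using f_int by (rule integral_unique)
  ultimately show ?thesis
    by (simp add: sums_def segment_transform_def c_def)
qed

text \<open>The power series is differentiated termwise: the shift of index turns the moment of
  order \<open>n + 1\<close> of \<open>\<phi>\<close> into the moment of order \<open>n\<close> of
  \<open>t * \<phi> t\<close>, and the remaining factors are the coefficients of
  \<open>h'\<close>.\<close>

lemma has_field_derivative_segment_transform:
  assumes \<phi>: "bounded_weight B \<phi>" and h: "h holomorphic_on ball 0 1" and z: "norm z < 1"
  shows "(segment_transform \<phi> h has_field_derivative
    segment_transform (\<lambda>t. of_real t * \<phi> t) (deriv h) z) (at z)"
proof -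
  define d where "d n = (deriv ^^ n) h 0 / fact n * integral {0..1} (\<lambda>t. \<phi> t * of_real t ^ n)" for n
  have d_sums: "(\<lambda>n. d n * w ^ n) sums segment_transform \<phi> h w" if "norm w < 1" for w
    using segment_transform_sums[OF \<phi> h that] by (simp add: d_def)
  have "diffs d n = (deriv ^^ n) (deriv h) 0 / fact n *
      integral {0..1} (\<lambda>t. (of_real t * \<phi> t) * of_real t ^ n)" for n
  proof -
    have "diffs d n = of_nat (Suc n) * ((deriv ^^ n) (deriv h) 0 / fact (Suc n)) *
        integral {0..1} (\<lambda>t. \<phi> t * of_real t ^ Suc n)"
      unfolding diffs_def d_def by (simp add: funpow_swap1 mult_ac)
    also have "of_nat (Suc n) * ((deriv ^^ n) (deriv h) 0 / fact (Suc n)) = (deriv ^^ n) (deriv h) 0 / fact n"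
      by (simp add: field_simps del: of_nat_Suc)
    finally show ?thesis by (simp add: mult_ac)
  qed
  then have "(\<Sum>n. diffs d n * z ^ n) = segment_transform (\<lambda>t. of_real t * \<phi> t) (deriv h) z"
    using segment_transform_sums[OF bounded_weight_mult_id[OF \<phi>] deriv_holomorphic_on_ball[OF h] z]
    by (simp add: sums_iff)
  moreover have "((\<lambda>z. \<Sum>n. d n * z ^ n) has_field_derivative (\<Sum>n. diffs d n * z ^ n)) (at z)"
    using d_sums z by (intro termdiffs_strong'[where K = 1]) (auto simp: sums_iff)
  ultimately have "((\<lambda>z. \<Sum>n. d n * z ^ n) has_field_derivative
      segment_transform (\<lambda>t. of_real t * \<phi> t) (deriv h) z) (at z)"
    by simp
  then show ?thesis
  proof (rule has_field_derivative_transform_within_open[where S = "ball 0 1"])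
    show "(\<Sum>n. d n * w ^ n) = segment_transform \<phi> h w" if "w \<in> ball 0 1" for w
      using d_sums[of w] that by (simp add: sums_iff)
  qed (use z in auto)
qed

lemma segment_transform_holomorphic:
  assumes "bounded_weight B \<phi>" "h holomorphic_on ball 0 1"
  shows "segment_transform \<phi> h holomorphic_on ball 0 1"
  unfolding holomorphic_on_open[OF open_ball]
  by (intro ballI exI, rule has_field_derivative_segment_transform[OF assms]) simp

lemma deriv_segment_transform:
  assumes "bounded_weight B \<phi>" "h holomorphic_on ball 0 1" "norm z < 1"
  shows "deriv (segment_transform \<phi> h) z = segment_transform (\<lambda>t. of_real t * \<phi> t) (deriv h) z"
  using has_field_derivative_segment_transform[OF assms] by (rule DERIV_imp_deriv)

lemma norm_segment_transform_0_le:
  assumes "bounded_weight B \<phi>"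
  shows "norm (segment_transform \<phi> h 0) \<le> B * norm (h 0)"
proof -
  have "norm (integral {0..1} (\<lambda>t. \<phi> t * h 0)) \<le> integral {0..1::real} (\<lambda>_. B * norm (h 0))"
    using assms bounded_weight_integrable[OF assms, of "\<lambda>_. h 0"]
    by (intro integral_norm_bound_integral)
       (auto simp: norm_mult bounded_weight_def intro!: mult_right_mono)
  then show ?thesis by (simp add: segment_transform_def)
qed

section \<open>Growth of the transform\<close>

text \<open>Minkowski's inequality in \<open>t\<close>: on the circle of radius \<open>r\<close> the
  slice at \<open>t\<close> is a mean of \<open>h\<close> at radius \<open>t * r\<close>. The
  majorant \<open>w\<close> is left free so that the order can be either kept or lowered.\<close>

lemma integral_mean_segment_transform_le:
  assumes p: "1 \<le> p" and \<phi>: "bounded_weight B \<phi>" and h: "mean_growth p \<beta> C h"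
    and r: "0 \<le> r" "r < 1"
    and w: "continuous_on {0..1} w"
      "\<And>t. 0 \<le> t \<Longrightarrow> t \<le> 1 \<Longrightarrow> (1 - t * r) powr - \<beta> \<le> w t"
  shows "integral_mean p r (segment_transform \<phi> h) \<le> B * C * integral {0..1} w"
proof (rule integral_mean_le_integral[where K = "\<lambda>t \<theta>. B * norm (h (of_real t * (of_real r * cis \<theta>)))"])
  note B = bounded_weight_nonneg[OF \<phi>] and C = mean_growthD(3)[OF h] and holh = mean_growthD(1)[OF h]
  have tr: "t * r < 1" "0 \<le> t * r" if "t \<in> {0..1}" for t
    using that r mult_left_le_one_le[of r t] by auto
  show "0 \<le> B * C" using B C by simp
  show "continuous_on (sphere 0 r) (segment_transform \<phi> h)"
    using segment_transform_holomorphic[OF \<phi> holh] r by (intro holomorphic_continuous_on_sphere)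
  show "continuous_on ({0..1} \<times> {0..2 * pi}) (\<lambda>(t, \<theta>). B * norm (h (of_real t * (of_real r * cis \<theta>))))"
    unfolding case_prod_unfold
    using tr r by (intro continuous_intros continuous_on_compose2[OF holomorphic_on_imp_continuous_on[OF holh]])
      (auto simp: norm_mult)
  show "0 < w t" if "t \<in> {0..1}" for t
    using w(2)[of t] tr[OF that] that by (auto intro: less_le_trans[rotated])
  show "norm (segment_transform \<phi> h (of_real r * cis \<theta>))
      \<le> integral {0..1} (\<lambda>t. B * norm (h (of_real t * (of_real r * cis \<theta>))))" for \<theta>
    unfolding segment_transform_def
  proof (intro integral_norm_bound_integral)
    have c: "continuous_on {0..1} (\<lambda>t. h (of_real t * (of_real r * cis \<theta>)))"
      using r by (intro continuous_on_segment holh) (auto simp: norm_mult)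
    show "(\<lambda>t. \<phi> t * h (of_real t * (of_real r * cis \<theta>))) integrable_on {0..1}"
      using \<phi> c by (rule bounded_weight_integrable)
    show "(\<lambda>t. B * norm (h (of_real t * (of_real r * cis \<theta>)))) integrable_on {0..1}"
      by (intro integrable_continuous_real continuous_intros c)
  qed (use \<phi> in \<open>auto simp: norm_mult bounded_weight_def intro!: mult_right_mono\<close>)
  fix t :: real assume t: "t \<in> {0..1}"
  have "integral_mean p (t * r) h \<le> C * (1 - t * r) powr - \<beta>"
    using mean_growthD(2)[OF h] tr[OF t] by simp
  also have "\<dots> \<le> C * w t" using w(2)[of t] t C by (intro mult_left_mono) auto
  finally have le: "integral_mean p (t * r) h \<le> C * w t" .
  then have "integral {0..2 * pi} (\<lambda>\<theta>. norm (h (of_real (t * r) * cis \<theta>)) powr p) \<le> 2 * pi * (C * w t) powr p"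
    using p order_trans[OF integral_mean_nonneg le] by (subst (asm) integral_mean_le_iff) auto
  then have "B powr p * integral {0..2 * pi} (\<lambda>\<theta>. norm (h (of_real (t * r) * cis \<theta>)) powr p)
      \<le> B powr p * (2 * pi * (C * w t) powr p)"
    by (rule mult_left_mono) auto
  then show "integral {0..2 * pi} (\<lambda>\<theta>. (B * norm (h (of_real t * (of_real r * cis \<theta>)))) powr p)
      \<le> 2 * pi * (B * C * w t) powr p"
    by (simp add: powr_mult mult_ac)
qed (use p r w in \<open>auto simp: bounded_weight_nonneg[OF \<phi>]\<close>)

lemma mean_growth_segment_transform:
  assumes p: "1 \<le> p" and \<beta>: "0 \<le> \<beta>" and \<phi>: "bounded_weight B \<phi>" and h: "mean_growth p \<beta> C h"
  shows "mean_growth p \<beta> (B * C) (segment_transform \<phi> h)"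
proof -
  have "integral_mean p r (segment_transform \<phi> h) \<le> B * C * (1 - r) powr - \<beta>" if r: "0 \<le> r" "r < 1" for r
  proof -
    have "(1 - t * r) powr - \<beta> \<le> (1 - r) powr - \<beta>" if "0 \<le> t" "t \<le> 1" for t
      using that r \<beta> mult_left_le_one_le[of r t] by (intro powr_mono2') auto
    then have "integral_mean p r (segment_transform \<phi> h) \<le> B * C * integral {0..1::real} (\<lambda>_. (1 - r) powr - \<beta>)"
      using p \<phi> h r by (intro integral_mean_segment_transform_le[where \<beta> = \<beta>]) auto
    then show ?thesis by simp
  qed
  then show ?thesis
    using segment_transform_holomorphic[OF \<phi> mean_growthD(1)[OF h]] by (auto simp: mean_growth_def)
qed

text \<open>Integrating \<open>(1 - t * r) powr - \<beta>\<close> over \<open>t\<close> lowers the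
  order by one when \<open>\<beta> > 1\<close>; at \<open>\<beta> = 1\<close> a logarithm would
  appear.\<close>

lemma mean_growth_segment_transform_gain:
  assumes p: "1 \<le> p" and \<beta>: "1 < \<beta>" and \<phi>: "bounded_weight B \<phi>" and h: "mean_growth p \<beta> C h"
  shows "mean_growth p (\<beta> - 1) (B * (C * (2 powr \<beta> / (\<beta> - 1)))) (segment_transform \<phi> h)"
proof -
  note B = bounded_weight_nonneg[OF \<phi>] and C = mean_growthD(3)[OF h]
  have "integral_mean p r (segment_transform \<phi> h) \<le> B * (C * (2 powr \<beta> / (\<beta> - 1))) * (1 - r) powr - (\<beta> - 1)"
    if r: "0 \<le> r" "r < 1" for r
  proof -
    \<comment> \<open>From \<open>t * r \<le> (t + r) / 2\<close> follows
      \<open>1 - t * r \<ge> (2 - r - t) / 2\<close>. The primitive of this majorant has no factor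
      \<open>1 / r\<close>, so \<open>r = 0\<close> is no special case.\<close>
    define w where "w t = 2 powr \<beta> * (2 - r - t) powr - \<beta>" for t
    have "(1 - t * r) powr - \<beta> \<le> w t" if t: "0 \<le> t" "t \<le> 1" for t
    proof -
      have "t * r \<le> r" "t * r \<le> t"
        using that r mult_left_le_one_le[of r t] mult_right_le_one_le[of t r] by auto
      then have "(1 - t * r) powr - \<beta> \<le> ((2 - r - t) / 2) powr - \<beta>"
        using t r \<beta> by (intro powr_mono2') (auto simp: field_simps)
      then show ?thesis
        using t r by (simp add: w_def powr_divide powr_minus field_simps)
    qed
    moreover have "continuous_on {0..1} w"
      unfolding w_def using r by (intro continuous_intros) auto
    ultimately have "integral_mean p r (segment_transform \<phi> h) \<le> B * C * integral {0..1} w"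
      using p \<phi> h r by (intro integral_mean_segment_transform_le[where \<beta> = \<beta>]) auto
    moreover have "integral {0..1} w \<le> 2 powr \<beta> / (\<beta> - 1) * (1 - r) powr - (\<beta> - 1)"
    proof -
      define W where "W t = 2 powr \<beta> / (\<beta> - 1) * (2 - r - t) powr - (\<beta> - 1)" for t
      have "(w has_integral (W 1 - W 0)) {0..1}"
      proof (rule fundamental_theorem_of_calculus)
        fix t :: real assume t: "t \<in> {0..1}"
        have pos: "0 < 2 - r - t" using t r by auto
        have "(W has_real_derivative 2 powr \<beta> / (\<beta> - 1) * (- (\<beta> - 1) * (2 - r - t) powr (- (\<beta> - 1) - 1) * (-1)))
            (at t within {0..1})"
          unfolding W_def using pos \<beta> by (auto intro!: derivative_eq_intros)
        also have "2 powr \<beta> / (\<beta> - 1) * (- (\<beta> - 1) * (2 - r - t) powr (- (\<beta> - 1) - 1) * (-1)) = w t"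
          using \<beta> by (simp add: w_def field_simps)
        finally show "(W has_vector_derivative w t) (at t within {0..1})"
          by (simp add: has_real_derivative_iff_has_vector_derivative)
      qed auto
      then have "integral {0..1} w = W 1 - W 0" by (rule integral_unique)
      also have "\<dots> \<le> W 1" using \<beta> by (simp add: W_def)
      also have "W 1 = 2 powr \<beta> / (\<beta> - 1) * (1 - r) powr - (\<beta> - 1)"
        by (simp add: W_def)
      finally show ?thesis .
    qed
    ultimately have "integral_mean p r (segment_transform \<phi> h)
        \<le> B * C * (2 powr \<beta> / (\<beta> - 1) * (1 - r) powr - (\<beta> - 1))"
      using mult_left_mono[of _ _ "B * C"] B C by (meson mult_nonneg_nonneg order_trans)
    then show ?thesis by (simp add: mult_ac)
  qed
  then show ?thesis
    using segment_transform_holomorphic[OF \<phi> mean_growthD(1)[OF h]] by (auto simp: mean_growth_def)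
qed

section \<open>Recovering \<open>f\<close> from \<open>f'\<close> and from
  \<open>f + z f'\<close>\<close>

lemma bounded_weight_1: "bounded_weight 1 (\<lambda>_. 1)"
  by (simp add: bounded_weight_def)

lemma has_vector_derivative_segment:
  assumes "f holomorphic_on ball 0 1" "norm z < 1" "t \<in> {0..1}"
  shows "((\<lambda>t. f (of_real t * z)) has_vector_derivative z * deriv f (of_real t * z)) (at t within {0..1})"
proof -
  have "t * norm z \<le> norm z" using assms(3) by (simp add: mult_left_le_one_le)
  then have "of_real t * z \<in> ball 0 1" using assms by (simp add: norm_mult)
  then have "(f has_field_derivative deriv f (of_real t * z)) (at (of_real t * z))"
    using assms(1) by (intro holomorphic_derivI[of f "ball 0 1"]) auto
  moreover have "((\<lambda>t. of_real t * z) has_vector_derivative z) (at t within {0..1})"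
    by (auto intro!: derivative_eq_intros)
  ultimately show ?thesis
    using field_vector_diff_chain_within[of "\<lambda>t. of_real t * z" z t "{0..1}" f] has_field_derivative_at_within
    by (fastforce simp: o_def)
qed

text \<open>The fundamental theorem of calculus on the segment from 0 to \<open>z\<close>.\<close>

lemma holomorphic_eq_segment_transform_deriv:
  assumes f: "f holomorphic_on ball 0 1" and z: "norm z < 1"
  shows "f z = f 0 + z * segment_transform (\<lambda>_. 1) (deriv f) z"
proof -
  have "((\<lambda>t. z * deriv f (of_real t * z)) has_integral (f (of_real 1 * z) - f (of_real 0 * z))) {0..1}"
    using has_vector_derivative_segment[OF f z] by (intro fundamental_theorem_of_calculus) auto
  from integral_unique[OF this] show ?thesis by (simp add: segment_transform_def)
qed

text \<open>The integrand is the derivative of \<open>t * f (t * z)\<close> in \<open>t\<close>, so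
  averaging over radii inverts \<open>f + z f'\<close>.\<close>

lemma holomorphic_eq_segment_transform_euler:
  assumes f: "f holomorphic_on ball 0 1" and z: "norm z < 1"
  shows "segment_transform (\<lambda>_. 1) (\<lambda>w. f w + w * deriv f w) z = f z"
proof -
  have "((\<lambda>t. 1 * (f (of_real t * z) + of_real t * z * deriv f (of_real t * z))) has_integral
      (of_real 1 * f (of_real 1 * z) - of_real 0 * f (of_real 0 * z))) {0..1}"
  proof (rule fundamental_theorem_of_calculus)
    fix t :: real assume "t \<in> {0..1}"
    have "((\<lambda>t. of_real t) has_vector_derivative (1 :: complex)) (at t within {0..1})"
      by (auto intro!: derivative_eq_intros)
    from has_vector_derivative_mult[OF this has_vector_derivative_segment[OF f z \<open>t \<in> {0..1}\<close>]]
    show "((\<lambda>t. of_real t * f (of_real t * z)) has_vector_derivative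
        1 * (f (of_real t * z) + of_real t * z * deriv f (of_real t * z))) (at t within {0..1})"
      by (simp add: algebra_simps)
  qed auto
  then show ?thesis by (simp add: segment_transform_def integral_unique)
qed

text \<open>Averaging over radii keeps the order, the factor \<open>z\<close> has modulus below 1,
  and the constant \<open>f 0\<close> has every nonnegative order.\<close>

lemma mean_growth_antideriv:
  assumes p: "1 \<le> p" and \<beta>: "0 \<le> \<beta>" and f: "f holomorphic_on ball 0 1"
    and f': "mean_growth p \<beta> C (deriv f)"
  shows "mean_growth p \<beta> (norm (f 0) + C) f"
proof -
  have "mean_growth p \<beta> (1 * (1 * C)) (\<lambda>z. z * segment_transform (\<lambda>_. 1) (deriv f) z)"
    using p \<beta> f' by (intro mean_growth_mult mean_growth_segment_transform bounded_weight_1) auto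
  then have "mean_growth p \<beta> (norm (f 0) + C) (\<lambda>z. f 0 + z * segment_transform (\<lambda>_. 1) (deriv f) z)"
    using p \<beta> by (intro mean_growth_add mean_growth_const) auto
  then show ?thesis
    by (rule mean_growth_cong) (metis holomorphic_eq_segment_transform_deriv f)
qed

lemma mean_growth_antideriv_gain:
  assumes p: "1 \<le> p" and \<beta>: "1 < \<beta>" and f: "f holomorphic_on ball 0 1"
    and f': "mean_growth p \<beta> C (deriv f)"
  shows "mean_growth p (\<beta> - 1) (norm (f 0) + C * (2 powr \<beta> / (\<beta> - 1))) f"
proof -
  have "mean_growth p (\<beta> - 1) (1 * (1 * (C * (2 powr \<beta> / (\<beta> - 1)))))
      (\<lambda>z. z * segment_transform (\<lambda>_. 1) (deriv f) z)"
    using p \<beta> f' by (intro mean_growth_mult mean_growth_segment_transform_gain bounded_weight_1) auto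
  then have "mean_growth p (\<beta> - 1) (norm (f 0) + C * (2 powr \<beta> / (\<beta> - 1)))
      (\<lambda>z. f 0 + z * segment_transform (\<lambda>_. 1) (deriv f) z)"
    using p \<beta> by (intro mean_growth_add mean_growth_const) auto
  then show ?thesis
    by (rule mean_growth_cong) (metis holomorphic_eq_segment_transform_deriv f)
qed

lemma mean_growth_euler:
  assumes p: "1 \<le> p" and \<beta>: "0 \<le> \<beta>" and f: "f holomorphic_on ball 0 1"
    and "mean_growth p \<beta> C (\<lambda>z. f z + z * deriv f z)"
  shows "mean_growth p \<beta> C f"
proof -
  have "mean_growth p \<beta> (1 * C) (segment_transform (\<lambda>_. 1) (\<lambda>z. f z + z * deriv f z))"
    using assms by (intro mean_growth_segment_transform bounded_weight_1)
  then show ?thesis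
    using holomorphic_eq_segment_transform_euler[OF f] by (auto intro: mean_growth_cong)
qed

section \<open>The operator \<open>D2\<close> as a differential expression\<close>

lemma deriv_power_series_sums:
  assumes f: "f holomorphic_on ball 0 1" and z: "norm z < 1"
  shows "(\<lambda>n. of_nat n * ((deriv ^^ n) f 0 / fact n) * z ^ n) sums (z * deriv f z)"
proof -
  have "(\<lambda>n. (deriv ^^ n) (deriv f) 0 / fact n * z ^ n) sums deriv f z"
    using holomorphic_power_series[OF deriv_holomorphic_on_ball[OF f], of z] z by simp
  then have "(\<lambda>n. z * ((deriv ^^ n) (deriv f) 0 / fact n * z ^ n)) sums (z * deriv f z)"
    by (rule sums_mult)
  moreover have "z * ((deriv ^^ n) (deriv f) 0 / fact n * z ^ n)
      = of_nat (Suc n) * ((deriv ^^ Suc n) f 0 / fact (Suc n)) * z ^ Suc n" for n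
    by (simp add: funpow_swap1 field_simps del: of_nat_Suc)
  ultimately have "(\<lambda>n. of_nat (Suc n) * ((deriv ^^ Suc n) f 0 / fact (Suc n)) * z ^ Suc n) sums (z * deriv f z)"
    by simp
  \<comment> \<open>The term for \<open>n = 0\<close> vanishes, so the index may start
    there.\<close>
  then show ?thesis by (subst (asm) sums_Suc_iff) simp
qed

text \<open>On coefficients this is the identity
  \<open>(n + 1)^2 = 1 + 3 * n + n * (n - 1)\<close>.\<close>

lemma D2_eq:
  assumes f: "f holomorphic_on ball 0 1" and z: "norm z < 1"
  shows "D2 f z = f z + 3 * z * deriv f z + z\<^sup>2 * deriv (deriv f) z"
proof -
  define a where "a n = (deriv ^^ n) f 0 / fact n" for n
  have "(\<lambda>n. of_nat n * ((deriv ^^ n) (deriv f) 0 / fact n) * z ^ n) sums (z * deriv (deriv f) z)"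
    by (rule deriv_power_series_sums[OF deriv_holomorphic_on_ball[OF f] z])
  then have "(\<lambda>n. z * (of_nat n * ((deriv ^^ n) (deriv f) 0 / fact n) * z ^ n)) sums (z * (z * deriv (deriv f) z))"
    by (rule sums_mult)
  moreover have "z * (of_nat n * ((deriv ^^ n) (deriv f) 0 / fact n) * z ^ n)
      = (of_nat (Suc n) - 1) * of_nat (Suc n) * a (Suc n) * z ^ Suc n" for n
  proof -
    have "a (Suc n) * of_nat (Suc n) = (deriv ^^ n) (deriv f) 0 / fact n"
      by (simp add: a_def funpow_swap1 field_simps del: of_nat_Suc)
    then show ?thesis by (simp add: mult_ac)
  qed
  ultimately have "(\<lambda>n. (of_nat (Suc n) - 1) * of_nat (Suc n) * a (Suc n) * z ^ Suc n) sums (z * (z * deriv (deriv f) z))"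
    by simp
  then have s2: "(\<lambda>n. (of_nat n - 1) * of_nat n * a n * z ^ n) sums (z * (z * deriv (deriv f) z))"
    by (subst (asm) sums_Suc_iff) simp
  have s1: "(\<lambda>n. of_nat n * a n * z ^ n) sums (z * deriv f z)"
    unfolding a_def by (rule deriv_power_series_sums[OF f z])
  have s0: "(\<lambda>n. a n * z ^ n) sums f z"
    using holomorphic_power_series[OF f, of z] z by (simp add: a_def)
  have "(\<lambda>n. a n * z ^ n + 3 * (of_nat n * a n * z ^ n) + (of_nat n - 1) * of_nat n * a n * z ^ n)
      sums (f z + 3 * (z * deriv f z) + z * (z * deriv (deriv f) z))"
    by (intro sums_add sums_mult s0 s1 s2)
  moreover have "a n * z ^ n + 3 * (of_nat n * a n * z ^ n) + (of_nat n - 1) * of_nat n * a n * z ^ n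
      = of_nat ((n + 1)\<^sup>2) * a n * z ^ n" for n
    by (simp add: power2_eq_square algebra_simps)
  ultimately show ?thesis
    by (simp add: D2_def a_def sums_iff power2_eq_square mult_ac)
qed

subsection \<open>The spaces in terms of second derivatives\<close>

text \<open>From \<open>1 - r^2 = (1 - r) * (1 + r)\<close> and
  \<open>1 \<le> 1 + r \<le> 2\<close>. The bounds translate between the weight of the Lipschitz
  spaces and that of \<open>mean_growth\<close>.\<close>

lemma one_minus_sq_powr_bounds:
  fixes r \<beta> :: real
  assumes "0 \<le> r" "r < 1" "0 \<le> \<beta>"
  shows "(1 - r\<^sup>2) powr - \<beta> \<le> (1 - r) powr - \<beta>"
    and "(1 - r\<^sup>2) powr \<beta> \<le> 2 powr \<beta> * (1 - r) powr \<beta>"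
proof -
  have eq: "1 - r\<^sup>2 = (1 - r) * (1 + r)" by (simp add: power2_eq_square algebra_simps)
  have "(1 - r) * 1 \<le> (1 - r) * (1 + r)" using assms by (intro mult_left_mono) auto
  then show "(1 - r\<^sup>2) powr - \<beta> \<le> (1 - r) powr - \<beta>"
    unfolding eq using assms by (intro powr_mono2') auto
  have "(1 - r) * (1 + r) \<le> (1 - r) * 2" using assms by (intro mult_left_mono) auto
  then have "(1 - r\<^sup>2) powr \<beta> \<le> ((1 - r) * 2) powr \<beta>"
    unfolding eq using assms by (intro powr_mono2) auto
  then show "(1 - r\<^sup>2) powr \<beta> \<le> 2 powr \<beta> * (1 - r) powr \<beta>"
    by (metis powr_mult mult.commute)
qed

text \<open>The big-O condition at 1 extends to all radii by compactness, and the weights in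
  \<open>1 - r^2\<close> and \<open>1 - r\<close> are comparable.\<close>

lemma mean_Lipschitz_iff_mean_growth:
  assumes p: "1 < p"
  shows "f \<in> mean_Lipschitz p \<longleftrightarrow>
    f holomorphic_on ball 0 1 \<and> (\<exists>C. mean_growth p (1 - 1 / p) C (deriv f))"
    (is "_ \<longleftrightarrow> ?R")
proof
  define \<beta> where "\<beta> = 1 - 1 / p"
  have \<beta>: "0 \<le> \<beta>" using p by (simp add: \<beta>_def)
  have exp: "- (1 - 1 / p) = - \<beta>" by (simp add: \<beta>_def)
  {
    assume f: "f \<in> mean_Lipschitz p"
    then have hol: "f holomorphic_on ball 0 1"
      and O: "(\<lambda>r. integral_mean p r (deriv f)) \<in> O[at_left 1](\<lambda>r. (1 - r\<^sup>2) powr - \<beta>)"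
      unfolding mean_Lipschitz_def exp by auto
    from O obtain c where c: "0 < c"
      "\<forall>\<^sub>F r in at_left 1. norm (integral_mean p r (deriv f)) \<le> c * norm ((1 - r\<^sup>2) powr - \<beta>)"
      by (rule landau_o.bigE)
    then obtain s where s: "s < 1"
      "\<And>r. s < r \<Longrightarrow> r < 1 \<Longrightarrow> norm (integral_mean p r (deriv f)) \<le> c * norm ((1 - r\<^sup>2) powr - \<beta>)"
      by (auto simp: eventually_at_left[of 0])
    have "\<exists>C. mean_growth p \<beta> C (deriv f)"
    proof (rule mean_growth_of_mean_growth_near_1[OF _ \<beta> deriv_holomorphic_on_ball[OF hol] \<open>s < 1\<close>])
      show "integral_mean p r (deriv f) \<le> c * (1 - r) powr - \<beta>" if "s < r" "r < 1" "0 \<le> r" for r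
      proof -
        have "integral_mean p r (deriv f) \<le> c * (1 - r\<^sup>2) powr - \<beta>"
          using s(2)[of r] that by simp
        also have "\<dots> \<le> c * (1 - r) powr - \<beta>"
          using one_minus_sq_powr_bounds(1)[of r \<beta>] that \<beta> \<open>0 < c\<close> by (intro mult_left_mono) auto
        finally show ?thesis .
      qed
    qed (use p in auto)
    then show ?R using hol by (simp add: \<beta>_def)
  next
    assume ?R
    then obtain C where hol: "f holomorphic_on ball 0 1" and C: "mean_growth p \<beta> C (deriv f)"
      by (auto simp: \<beta>_def)
    have "(\<lambda>r. integral_mean p r (deriv f)) \<in> O[at_left 1](\<lambda>r. (1 - r\<^sup>2) powr - \<beta>)"
    proof (rule bigoI[where c = "C * 2 powr \<beta>"])
      have "\<forall>\<^sub>F r in at_left 1. r \<in> {0<..<1::real}"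
        by (rule eventually_at_left_real) simp
      then show "\<forall>\<^sub>F r in at_left 1. norm (integral_mean p r (deriv f)) \<le> C * 2 powr \<beta> * norm ((1 - r\<^sup>2) powr - \<beta>)"
      proof eventually_elim
        case (elim r)
        then have r: "0 \<le> r" "r < 1" by auto
        have pos: "0 < 1 - r" "0 < 1 - r\<^sup>2"
          using r by (auto simp: abs_square_less_1)
        have "(1 - r) powr - \<beta> \<le> 2 powr \<beta> * (1 - r\<^sup>2) powr - \<beta>"
          using one_minus_sq_powr_bounds(2)[OF r \<beta>] pos by (simp add: powr_minus field_simps)
        then have "C * (1 - r) powr - \<beta> \<le> C * (2 powr \<beta> * (1 - r\<^sup>2) powr - \<beta>)"
          using mean_growthD(3)[OF C] by (rule mult_left_mono)
        then show ?case
          using mean_growthD(2)[OF C r] integral_mean_nonneg[of p r "deriv f"] by (simp add: mult_ac)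
      qed
    qed
    then show "f \<in> mean_Lipschitz p"
      using hol unfolding mean_Lipschitz_def exp by simp
  }
qed

lemma mean_Lipschitz_norm_le:
  assumes p: "1 < p" and C: "mean_growth p (1 - 1 / p) C (deriv f)"
  shows "mean_Lipschitz_norm p f \<le> norm (f 0) + 2 powr (1 - 1 / p) * C"
proof -
  define \<beta> where "\<beta> = 1 - 1 / p"
  have \<beta>: "0 \<le> \<beta>" using p by (simp add: \<beta>_def)
  have "(1 - r\<^sup>2) powr \<beta> * integral_mean p r (deriv f) \<le> 2 powr \<beta> * C" if r: "r \<in> {0..<1}" for r
  proof -
    have "(1 - r\<^sup>2) powr \<beta> * integral_mean p r (deriv f)
        \<le> (2 powr \<beta> * (1 - r) powr \<beta>) * (C * (1 - r) powr - \<beta>)"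
      using one_minus_sq_powr_bounds(2)[of r \<beta>] mean_growthD(2)[OF C] r \<beta> integral_mean_nonneg
      by (intro mult_mono) (auto simp: \<beta>_def)
    also have "\<dots> = 2 powr \<beta> * C" using r by (simp add: powr_minus)
    finally show ?thesis .
  qed
  then show ?thesis
    unfolding mean_Lipschitz_norm_def \<beta>_def by (intro add_left_mono cSUP_least) auto
qed

text \<open>By \<open>D2_eq\<close> the means of \<open>D2 f\<close> are those of the differential
  expression, which is visibly holomorphic, as \<open>mean_growth\<close> demands. A bound for the
  supremum is then the same as a growth constant.\<close>

lemma H_1_inf_1_2_iff_mean_growth:
  assumes f: "f holomorphic_on ball 0 1"
  shows "f \<in> H_1_inf_1_2 \<longleftrightarrow>
    (\<exists>C. mean_growth 1 1 C (\<lambda>z. f z + 3 * z * deriv f z + z\<^sup>2 * deriv (deriv f) z))"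
    (is "_ \<longleftrightarrow> (\<exists>C. mean_growth 1 1 C ?e)")
    and "mean_growth 1 1 C (\<lambda>z. f z + 3 * z * deriv f z + z\<^sup>2 * deriv (deriv f) z) \<Longrightarrow>
      H_1_inf_1_2_norm f \<le> C"
proof -
  have hol: "?e holomorphic_on ball 0 1"
    using f by (intro holomorphic_intros deriv_holomorphic_on_ball)
  have eq: "integral_mean 1 r (D2 f) = integral_mean 1 r ?e" if "0 \<le> r" "r < 1" for r
    using that by (intro integral_mean_cong) (simp_all add: D2_eq[OF f])
  have iff: "(1 - r) * integral_mean 1 r (D2 f) \<le> C \<longleftrightarrow> integral_mean 1 r ?e \<le> C * (1 - r) powr - 1"
    if "0 \<le> r" "r < 1" for r C
    using that unfolding eq[OF that] by (simp add: powr_minus_divide pos_le_divide_eq mult.commute)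
  show "f \<in> H_1_inf_1_2 \<longleftrightarrow> (\<exists>C. mean_growth 1 1 C ?e)"
  proof -
    have "f \<in> H_1_inf_1_2 \<longleftrightarrow> (\<exists>C. \<forall>r\<in>{0..<1}. (1 - r) * integral_mean 1 r (D2 f) \<le> C)"
      using f by (auto simp: H_1_inf_1_2_def bdd_above_def)
    also have "\<dots> \<longleftrightarrow> (\<exists>C. mean_growth 1 1 C ?e)"
      unfolding mean_growth_def using hol iff by auto
    finally show ?thesis .
  qed
  show "H_1_inf_1_2_norm f \<le> C" if "mean_growth 1 1 C ?e"
    unfolding H_1_inf_1_2_norm_def using that iff
    by (intro cSUP_least) (auto simp: mean_growth_def)
qed

text \<open>Two integrations carry the order over to \<open>f'\<close> and \<open>f\<close>. The
  coefficients \<open>1\<close>, \<open>3 * z\<close>, \<open>z^2\<close> are bounded by 1, 3, 1,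
  whose sum is the factor 5.\<close>

lemma mean_growth_D2_of_deriv2:
  assumes f: "f holomorphic_on ball 0 1" and C: "mean_growth 1 1 C (deriv (deriv f))"
  shows "mean_growth 1 1 (5 * (norm (f 0) + norm (deriv f 0) + C))
    (\<lambda>z. f z + 3 * z * deriv f z + z\<^sup>2 * deriv (deriv f) z)"
proof -
  have f': "mean_growth 1 1 (norm (deriv f 0) + C) (deriv f)"
    using C by (intro mean_growth_antideriv deriv_holomorphic_on_ball f) auto
  have f0: "mean_growth 1 1 (norm (f 0) + (norm (deriv f 0) + C)) f"
    using f' by (intro mean_growth_antideriv[OF _ _ f]) auto
  have "mean_growth 1 1 (norm (f 0) + (norm (deriv f 0) + C) + 3 * (norm (deriv f 0) + C) + 1 * C)
      (\<lambda>z. f z + 3 * z * deriv f z + z\<^sup>2 * deriv (deriv f) z)"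
    by (intro mean_growth_add mean_growth_mult f0 f' C holomorphic_intros)
       (auto simp: norm_mult norm_power power_le_one)
  then show ?thesis
    using mean_growthD(3)[OF C] by (elim mean_growth_mono) simp
qed

text \<open>With \<open>E v = v + z v'\<close> the expression is \<open>E (E f)\<close>. Averaging
  over radii removes one \<open>E\<close> at a time, after which \<open>z^2 f''\<close> is a
  combination of functions of order 1; division by \<open>z^2\<close> is harmless away from
  0.\<close>

lemma mean_growth_deriv2_of_D2:
  assumes f: "f holomorphic_on ball 0 1"
    and C: "mean_growth 1 1 C (\<lambda>z. f z + 3 * z * deriv f z + z\<^sup>2 * deriv (deriv f) z)"
      (is "mean_growth _ _ _ ?e")
  shows "\<exists>C'. mean_growth 1 1 C' (deriv (deriv f))"
proof -
  let ?D = "\<lambda>z. f z + z * deriv f z"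
  note f' = deriv_holomorphic_on_ball[OF f] and f'' = deriv_holomorphic_on_ball[OF deriv_holomorphic_on_ball[OF f]]
  have D': "deriv ?D z = 2 * deriv f z + z * deriv (deriv f) z" if "norm z < 1" for z
  proof (rule DERIV_imp_deriv)
    have "(f has_field_derivative deriv f z) (at z)" "(deriv f has_field_derivative deriv (deriv f) z) (at z)"
      using that f f' by (auto intro: holomorphic_derivI)
    then show "(?D has_field_derivative 2 * deriv f z + z * deriv (deriv f) z) (at z)"
      by (auto intro!: derivative_eq_intros)
  qed
  have "mean_growth 1 1 C (\<lambda>z. ?D z + z * deriv ?D z)"
    using C by (rule mean_growth_cong) (simp add: D' algebra_simps power2_eq_square)
  then have D: "mean_growth 1 1 C ?D"
    by (rule mean_growth_euler[rotated 3]) (use f f' in \<open>auto intro!: holomorphic_intros\<close>)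
  then have f0: "mean_growth 1 1 C f"
    by (rule mean_growth_euler[OF _ _ f, rotated 2]) auto
  \<comment> \<open>The combination is \<open>z^2 f'' = E (E f) - 3 E f + 2 f\<close>.\<close>
  have "mean_growth 1 1 (C + 3 * C + 2 * C) (\<lambda>z. ?e z + (- 3) * ?D z + 2 * f z)"
    by (intro mean_growth_add mean_growth_mult C D f0 holomorphic_intros) auto
  then have z2: "mean_growth 1 1 (C + 3 * C + 2 * C) (\<lambda>z. z\<^sup>2 * deriv (deriv f) z)"
    by (rule mean_growth_cong) (simp add: algebra_simps)
  show ?thesis
  \<comment> \<open>For \<open>r > 1 / 2\<close> one has \<open>1 \<le> 4 * r^2\<close>, so dividing
    by \<open>z^2\<close> costs a factor 4; this gives \<open>4 * 6 = 24\<close>.\<close>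
  proof (rule mean_growth_of_mean_growth_near_1[where s = "1 / 2", OF _ _ f''])
    fix r :: real assume r: "1 / 2 < r" "r < 1"
    have "integral_mean 1 r (deriv (deriv f)) \<le> integral_mean 1 r (\<lambda>z. 4 * (z\<^sup>2 * deriv (deriv f) z))"
    proof (intro integral_mean_mono holomorphic_continuous_on_sphere holomorphic_intros f'')
      fix z :: complex assume "norm z = r"
      moreover have "1 \<le> 4 * r\<^sup>2"
        using r power_mono[of "1 / 2" r 2] by (simp add: power2_eq_square)
      ultimately show "norm (deriv (deriv f) z) \<le> norm (4 * (z\<^sup>2 * deriv (deriv f) z))"
        using mult_right_mono[of 1 "4 * r\<^sup>2" "norm (deriv (deriv f) z)"]
        by (simp add: norm_mult norm_power)
    qed (use r f in auto)
    also have "\<dots> = 4 * integral_mean 1 r (\<lambda>z. z\<^sup>2 * deriv (deriv f) z)"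
      using r mean_growthD(1)[OF z2] by (subst integral_mean_scale) (auto intro: holomorphic_continuous_on_sphere)
    also have "\<dots> \<le> 4 * ((C + 3 * C + 2 * C) * (1 - r) powr - 1)"
      using mean_growthD(2)[OF z2] r by (intro mult_left_mono) auto
    finally show "integral_mean 1 r (deriv (deriv f)) \<le> 24 * C * (1 - r) powr - 1"
      by simp
  qed auto
qed

section \<open>A common criterion and norm bound for all \<open>p\<close>\<close>

text \<open>For \<open>p > 1\<close> the order rises by one under differentiation and falls back
  under integration, where \<open>2 - 1 / p > 1\<close> is needed. For \<open>p = 1\<close> this
  order is 1 and the lemmas on \<open>D2\<close> take over.\<close>

lemma X_space_iff_mean_growth_deriv2:
  assumes p: "1 \<le> p"
  shows "f \<in> X_space p \<longleftrightarrow>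
    f holomorphic_on ball 0 1 \<and> (\<exists>C. mean_growth p (2 - 1 / p) C (deriv (deriv f)))"
proof (cases "p = 1")
  case True
  have "f \<in> H_1_inf_1_2 \<Longrightarrow> f holomorphic_on ball 0 1" by (simp add: H_1_inf_1_2_def)
  then show ?thesis
    using True H_1_inf_1_2_iff_mean_growth(1)[of f] mean_growth_D2_of_deriv2[of f] mean_growth_deriv2_of_D2[of f]
    by (auto simp: X_space_def)
next
  case False
  then have p1: "1 < p" using p by simp
  have "(\<exists>C. mean_growth p (1 - 1 / p) C (deriv f)) \<longleftrightarrow> (\<exists>C. mean_growth p (2 - 1 / p) C (deriv (deriv f)))"
    if f: "f holomorphic_on ball 0 1"
  proof
    assume "\<exists>C. mean_growth p (1 - 1 / p) C (deriv f)"
    then obtain C where "mean_growth p (1 - 1 / p) C (deriv f)" ..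
    from mean_growth_deriv[OF p _ this] p1
    show "\<exists>C. mean_growth p (2 - 1 / p) C (deriv (deriv f))" by (auto simp: algebra_simps)
  next
    assume "\<exists>C. mean_growth p (2 - 1 / p) C (deriv (deriv f))"
    then obtain C where "mean_growth p (2 - 1 / p) C (deriv (deriv f))" ..
    from mean_growth_antideriv_gain[OF p _ deriv_holomorphic_on_ball[OF f] this] p1
    show "\<exists>C. mean_growth p (1 - 1 / p) C (deriv f)" by (auto simp: algebra_simps)
  qed
  then show ?thesis
    using False mean_Lipschitz_iff_mean_growth[OF p1, of f] by (auto simp: X_space_def)
qed

text \<open>\<open>K\<close> depends on \<open>p\<close> alone and the bound is linear in the data
  of \<open>f\<close>, which turns growth constants into an operator bound.\<close>

lemma X_norm_le:
  assumes p: "1 \<le> p"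
  obtains K where "0 \<le> K" "\<And>f C. f holomorphic_on ball 0 1 \<Longrightarrow>
    mean_growth p (2 - 1 / p) C (deriv (deriv f)) \<Longrightarrow>
    X_norm p f \<le> K * (norm (f 0) + norm (deriv f 0) + C)"
proof (cases "p = 1")
  case True
  show ?thesis
  proof (rule that[of 5])
    fix f C
    assume "f holomorphic_on ball 0 1" "mean_growth p (2 - 1 / p) C (deriv (deriv f))"
    then show "X_norm p f \<le> 5 * (norm (f 0) + norm (deriv f 0) + C)"
      using True H_1_inf_1_2_iff_mean_growth(2)[OF _ mean_growth_D2_of_deriv2] by (simp add: X_norm_def)
  qed simp
next
  case False
  then have p1: "1 < p" using p by simp
  define \<gamma> where "\<gamma> = 2 - 1 / p"
  have \<gamma>: "1 < \<gamma>" "1 - 1 / p = \<gamma> - 1" using p1 by (auto simp: \<gamma>_def)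
  define M where "M = 2 powr \<gamma> / (\<gamma> - 1)"
  define L where "L = 2 powr (\<gamma> - 1)"
  have nonneg: "0 \<le> M" "0 \<le> L" using \<gamma> by (auto simp: M_def L_def)
  show ?thesis
  \<comment> \<open>A common bound for the coefficients \<open>1\<close>, \<open>L\<close> and
    \<open>L * M\<close> of the three terms.\<close>
  proof (rule that[of "1 + L + L * M"])
    fix f C
    assume f: "f holomorphic_on ball 0 1" and C: "mean_growth p (2 - 1 / p) C (deriv (deriv f))"
    have "mean_growth p (1 - 1 / p) (norm (deriv f 0) + C * M) (deriv f)"
      unfolding \<gamma>(2) M_def
      using C p \<gamma>(1) by (intro mean_growth_antideriv_gain deriv_holomorphic_on_ball f) (auto simp: \<gamma>_def)
    from mean_Lipschitz_norm_le[OF p1 this]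
    have "X_norm p f \<le> norm (f 0) + L * (norm (deriv f 0) + C * M)"
      using False by (simp add: X_norm_def L_def \<gamma>(2))
    also have "\<dots> = 1 * norm (f 0) + L * norm (deriv f 0) + L * M * C"
      by (simp add: algebra_simps)
    also have "\<dots> \<le> (1 + L + L * M) * norm (f 0) + (1 + L + L * M) * norm (deriv f 0) + (1 + L + L * M) * C"
      using nonneg mean_growthD(3)[OF C] by (intro add_mono mult_right_mono) auto
    finally show "X_norm p f \<le> (1 + L + L * M) * (norm (f 0) + norm (deriv f 0) + C)"
      by (simp add: algebra_simps)
  qed (use nonneg in auto)
qed

subsection \<open>The generalized Hilbert operator\<close>

text \<open>On the segment \<open>f\<close> becomes a weight bounded by its sup norm, so that this
  norm enters the estimates for the transform linearly.\<close>

lemma gen_hilbert_eq_segment_transform: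
  assumes f: "f \<in> H_infinity"
  obtains \<phi> where "bounded_weight (H_infinity_norm f) \<phi>"
    "gen_hilbert g f = segment_transform \<phi> (deriv g)"
proof
  \<comment> \<open>\<^term>\<open>f 1\<close> is arbitrary and need not be bounded by the norm, hence the cut-off at \<^term>\<open>1::real\<close>.\<close>
  define \<phi> where "\<phi> t = (if t \<in> {0..<1} then f (of_real t) else 0)" for t :: real
  have hol: "f holomorphic_on ball 0 1" and bdd: "bdd_above ((\<lambda>z. norm (f z)) ` ball 0 1)"
    using f by (auto simp: H_infinity_def bounded_iff bdd_above_def)
  have le: "norm (f z) \<le> H_infinity_norm f" if "norm z < 1" for z
    unfolding H_infinity_norm_def using bdd that by (intro cSUP_upper) auto
  have "(\<lambda>t. f (of_real t)) \<in> borel_measurable (lebesgue_on {0..<1::real})"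
    by (intro continuous_imp_measurable_on_sets_lebesgue
          continuous_on_compose2[OF holomorphic_on_imp_continuous_on[OF hol]] continuous_intros) auto
  then have "\<phi> \<in> borel_measurable lebesgue"
    unfolding \<phi>_def by (subst borel_measurable_if) auto
  then have "\<phi> \<in> borel_measurable (lebesgue_on {0..1})"
    by (rule measurable_restrict_space1)
  moreover have "norm (\<phi> t) \<le> H_infinity_norm f" for t
    using le[of "of_real t"] order_trans[OF norm_ge_zero le[of 0]] by (auto simp: \<phi>_def)
  ultimately show "bounded_weight (H_infinity_norm f) \<phi>"
    by (simp add: bounded_weight_def)
  show "gen_hilbert g f = segment_transform \<phi> (deriv g)"
  proof
    fix z
    show "gen_hilbert g f z = segment_transform \<phi> (deriv g) z"
      unfolding gen_hilbert_def segment_transform_def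
      by (rule integral_spike[of "{1}"]) (auto simp: \<phi>_def)
  qed
qed

theorem theorem3p1:
  fixes p :: real and g :: "complex \<Rightarrow> complex"
  assumes "1 \<le> p" and "g holomorphic_on ball 0 1"
  shows "bounded_operator H_infinity H_infinity_norm (X_space p) (X_norm p) (gen_hilbert g)
           \<longleftrightarrow> g \<in> X_space p"
proof
  note p = assms(1) and g = assms(2)
  \<comment> \<open>The order of the second derivative that characterizes \<open>X_space p\<close>;
    it equals 1 at \<open>p = 1\<close>.\<close>
  define \<gamma> where "\<gamma> = 2 - 1 / p"
  have \<gamma>: "1 \<le> \<gamma>" using p by (simp add: \<gamma>_def)
  note g' = deriv_holomorphic_on_ball[OF g]
  note g'' = deriv_holomorphic_on_ball[OF g']
  {
    assume "bounded_operator H_infinity H_infinity_norm (X_space p) (X_norm p) (gen_hilbert g)"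
    \<comment> \<open>Testing on the constant 1 suffices, because \<open>g\<close> is recovered from
      its image \<open>h\<close> by \<open>g = g 0 + z h\<close>.\<close>
    moreover have "(\<lambda>_. 1) \<in> H_infinity"
      by (auto simp: H_infinity_def bounded_iff)
    ultimately have "gen_hilbert g (\<lambda>_. 1) \<in> X_space p"
      by (simp add: bounded_operator_def)
    moreover define h where "h = segment_transform (\<lambda>_. 1) (deriv g)"
    moreover have "gen_hilbert g (\<lambda>_. 1) = h"
      by (simp add: fun_eq_iff h_def gen_hilbert_def segment_transform_def)
    ultimately obtain C where h: "h holomorphic_on ball 0 1" and C: "mean_growth p \<gamma> C (deriv (deriv h))"
      using X_space_iff_mean_growth_deriv2[OF p] by (auto simp: \<gamma>_def)
    note h' = deriv_holomorphic_on_ball[OF h]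
    have dg: "deriv g z = h z + z * deriv h z" if z: "norm z < 1" for z
    proof (rule DERIV_imp_deriv, rule has_field_derivative_transform_within_open)
      show "((\<lambda>z. g 0 + z * h z) has_field_derivative h z + z * deriv h z) (at z)"
        using z by (auto intro!: derivative_eq_intros holomorphic_derivI[OF h])
      show "g 0 + w * h w = g w" if "w \<in> ball 0 1" for w
        using holomorphic_eq_segment_transform_deriv[OF g, of w] that by (simp add: h_def)
    qed (use z in auto)
    have ddg: "deriv (deriv g) z = 2 * deriv h z + z * deriv (deriv h) z" if z: "norm z < 1" for z
    proof (rule DERIV_imp_deriv, rule has_field_derivative_transform_within_open)
      show "((\<lambda>z. h z + z * deriv h z) has_field_derivative 2 * deriv h z + z * deriv (deriv h) z) (at z)"
        using z by (auto intro!: derivative_eq_intros holomorphic_derivI[OF h] holomorphic_derivI[OF h'])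
      show "h w + w * deriv h w = deriv g w" if "w \<in> ball 0 1" for w
        using dg that by simp
    qed (use z in auto)
    \<comment> \<open>Integration carries the order \<open>\<gamma>\<close> of \<open>h''\<close>
      over to \<open>h'\<close>, and the bounded factors 2 and \<open>z\<close> preserve it.\<close>
    have "mean_growth p \<gamma> (2 * (norm (deriv h 0) + C) + 1 * C) (\<lambda>z. 2 * deriv h z + z * deriv (deriv h) z)"
      using p \<gamma> h h' by (intro mean_growth_add mean_growth_mult mean_growth_antideriv C holomorphic_intros) auto
    then have "mean_growth p \<gamma> (2 * (norm (deriv h 0) + C) + 1 * C) (deriv (deriv g))"
      by (rule mean_growth_cong) (simp add: ddg)
    then show "g \<in> X_space p"
      using X_space_iff_mean_growth_deriv2[OF p] g by (auto simp: \<gamma>_def)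
  next
    assume "g \<in> X_space p"
    then obtain C where "mean_growth p \<gamma> C (deriv (deriv g))"
      using X_space_iff_mean_growth_deriv2[OF p] by (auto simp: \<gamma>_def)
    \<comment> \<open>One further derivative raises the order to \<open>\<gamma> + 1 > 1\<close>, so
      that the transform gains a power even when \<open>\<gamma> = 1\<close>.\<close>
    from mean_growth_deriv[OF p _ this] \<gamma>
    obtain D where D: "mean_growth p (\<gamma> + 1) D (deriv (deriv (deriv g)))" by auto
    \<comment> \<open>The constant of \<open>mean_growth_segment_transform_gain\<close> at order
      \<open>\<gamma> + 1\<close>, apart from the bound of the weight.\<close>
    define E where "E = D * (2 powr (\<gamma> + 1) / \<gamma>)"
    \<comment> \<open>The three quantities that enter \<open>X_norm_le\<close> are each bounded
      linearly in the sup norm of \<open>f\<close>.\<close>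
    have key: "gen_hilbert g f holomorphic_on ball 0 1"
      "mean_growth p \<gamma> (H_infinity_norm f * E) (deriv (deriv (gen_hilbert g f)))"
      "norm (gen_hilbert g f 0) \<le> H_infinity_norm f * norm (deriv g 0)"
      "norm (deriv (gen_hilbert g f) 0) \<le> H_infinity_norm f * norm (deriv (deriv g) 0)"
      if "f \<in> H_infinity" for f
    proof -
      obtain \<phi> where \<phi>: "bounded_weight (H_infinity_norm f) \<phi>"
        and F: "gen_hilbert g f = segment_transform \<phi> (deriv g)"
        using gen_hilbert_eq_segment_transform[OF \<open>f \<in> H_infinity\<close>] by blast
      \<comment> \<open>Each derivative of the transform multiplies the weight by \<open>t\<close>,
        and \<open>0 \<le> t \<le> 1\<close> preserves its bound.\<close>
      note \<phi>1 = bounded_weight_mult_id[OF \<phi>]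
      note \<phi>2 = bounded_weight_mult_id[OF \<phi>1]
      show "gen_hilbert g f holomorphic_on ball 0 1"
        unfolding F using \<phi> g' by (rule segment_transform_holomorphic)
      have d1: "deriv (gen_hilbert g f) z = segment_transform (\<lambda>t. of_real t * \<phi> t) (deriv (deriv g)) z"
        if "norm z < 1" for z
        unfolding F using \<phi> g' that by (rule deriv_segment_transform)
      have d2: "deriv (deriv (gen_hilbert g f)) z =
          segment_transform (\<lambda>t. of_real t * (of_real t * \<phi> t)) (deriv (deriv (deriv g))) z"
        if z: "norm z < 1" for z
      \<comment> \<open>\<open>d1\<close> is available on the disc, an open set, which is enough to
        differentiate it once more.\<close>
      proof (rule DERIV_imp_deriv, rule has_field_derivative_transform_within_open[where S = "ball 0 1"])
        show "(segment_transform (\<lambda>t. of_real t * \<phi> t) (deriv (deriv g)) has_field_derivative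
            segment_transform (\<lambda>t. of_real t * (of_real t * \<phi> t)) (deriv (deriv (deriv g))) z) (at z)"
          using \<phi>1 g'' z by (rule has_field_derivative_segment_transform)
      qed (use z d1 in auto)
      have "mean_growth p (\<gamma> + 1 - 1) (H_infinity_norm f * (D * (2 powr (\<gamma> + 1) / (\<gamma> + 1 - 1))))
          (segment_transform (\<lambda>t. of_real t * (of_real t * \<phi> t)) (deriv (deriv (deriv g))))"
        using p \<gamma> \<phi>2 D by (intro mean_growth_segment_transform_gain) auto
      then have "mean_growth p \<gamma> (H_infinity_norm f * E)
          (segment_transform (\<lambda>t. of_real t * (of_real t * \<phi> t)) (deriv (deriv (deriv g))))"
        by (simp add: E_def)
      then show "mean_growth p \<gamma> (H_infinity_norm f * E) (deriv (deriv (gen_hilbert g f)))"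
        by (rule mean_growth_cong) (simp add: d2)
      show "norm (gen_hilbert g f 0) \<le> H_infinity_norm f * norm (deriv g 0)"
        unfolding F using \<phi> by (rule norm_segment_transform_0_le)
      show "norm (deriv (gen_hilbert g f) 0) \<le> H_infinity_norm f * norm (deriv (deriv g) 0)"
        using norm_segment_transform_0_le[OF \<phi>1, of "deriv (deriv g)"] d1[of 0] by simp
    qed
    obtain K where K: "0 \<le> K" "\<And>f C. f holomorphic_on ball 0 1 \<Longrightarrow>
        mean_growth p \<gamma> C (deriv (deriv f)) \<Longrightarrow> X_norm p f \<le> K * (norm (f 0) + norm (deriv f 0) + C)"
      using X_norm_le[OF p] unfolding \<gamma>_def by blast
    have "X_norm p (gen_hilbert g f) \<le> K * (norm (deriv g 0) + norm (deriv (deriv g) 0) + E) * H_infinity_norm f"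
      if f: "f \<in> H_infinity" for f
    proof -
      have "X_norm p (gen_hilbert g f)
          \<le> K * (norm (gen_hilbert g f 0) + norm (deriv (gen_hilbert g f) 0) + H_infinity_norm f * E)"
        using key[OF f] by (intro K(2))
      also have "\<dots> \<le> K * (H_infinity_norm f * norm (deriv g 0) + H_infinity_norm f * norm (deriv (deriv g) 0)
          + H_infinity_norm f * E)"
        using key[OF f] K(1) by (intro mult_left_mono[where c = K] add_mono) auto
      also have "\<dots> = K * (norm (deriv g 0) + norm (deriv (deriv g) 0) + E) * H_infinity_norm f"
        by (simp add: algebra_simps)
      finally show ?thesis .
    qed
    moreover have "gen_hilbert g f \<in> X_space p" if "f \<in> H_infinity" for f
      using key(1,2)[OF that] X_space_iff_mean_growth_deriv2[OF p] by (auto simp: \<gamma>_def)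
    ultimately show "bounded_operator H_infinity H_infinity_norm (X_space p) (X_norm p) (gen_hilbert g)"
      unfolding bounded_operator_def by blast
  }
qed

end
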